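(* Let $d\ge1$, $\alpha\in(0,2)$, $x_0\in\mathbb{R}^d$, and let $f:\mathbb{R}^d\to\mathbb{R}^d$ and $g:\mathbb{R}^d\to\mathbb{R}^{d\times d}$ be Borel measurable. Assume that there exist constants $\gamma>\lambda>1$ and $H\ge1$ such that $$\max\{|f(x)|,|g(x)|\}\ge \frac1H|x|^\gamma\quad\text{and}\quad \min\{|f(x)|,|g(x)|\}\le H|x|^\lambda\qquad\text{for all } |x|\ge H,$$ and assume that $g(x_0)\ne0$. Let $T>0$ be arbitrary and, for $n\in\mathbb{N}$, let $\eta=T/n$. Let $(Z_t)_{t\ge0}$ be the standard $d$-dimensional rotationally invariant $\alpha$-stable process, let $\widetilde Z_1,\widetilde Z_2,\dots$ be i.i.d. Pareto-distributed random vectors in $\mathbb{R}^d$ with parameter $\alpha$, and for $k\in\{0,1,\dots,n-1\}$ define $$Y_{k+1}=Y_k+\eta f(Y_k)+g(Y_k)\big(Z_{(k+1)\eta}-Z_{k\eta}\big),\qquad Y_0=x_0,$$ $$\widetilde Y_{k+1}=\widetilde Y_k+\eta f(\widetilde Y_k)+\frac1\sigma\eta^{1/\alpha}g(\widetilde Y_k)\widetilde Z_{k+1},\qquad \widetilde Y_0=x_0.$$ Then there exists a constant $c>1$ such that: (i) there exists a sequence of non-empty events $\Omega_n\subseteq\Omega$, $n\in\mathbb{N}$, such that $\mathbb{P}(\Omega_n)\ge c\,n^{-c}\delta_\alpha^{-n}$ and $|Y_n(\omega)|\ge 2^{\lambda^{n-1}}$ for all $\omega\in\Omega_n$ and all $n\in\mathbb{N}$;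 (ii) there exists a sequence of non-empty events $\widetilde\Omega_n\subseteq\Omega$, $n\in\mathbb{N}$, such that $\mathbb{P}(\widetilde\Omega_n)\ge c\,n^{-c}\kappa_\alpha^{-n}$ and $|\widetilde Y_n(\omega)|\ge 2^{\lambda^{n-1}}$ for all $\omega\in\widetilde\Omega_n$ and all $n\in\mathbb{N}$. Consequently, for any $\beta\in(0,\alpha)$, $$\lim_{n\to\infty}\mathbb{E}|Y_n|^\beta=\infty\quad\text{and}\quad\lim_{n\to\infty}\mathbb{E}|\widetilde Y_n|^\beta=\infty.$$
   Context: All random variables live on a probability space $(\Omega,\mathcal F,\mathbb P)$; $|\cdot|$ is the Euclidean norm for vectors and a matrix norm (say the operator norm) for matrices. For each $n$ the schemes are run with step size $\eta=T/n$, so $Y_n$ (resp. $\widetilde Y_n$) is the $n$-th iterate of the scheme with step size $T/n$; expectations take values in $[0,\infty]$. Stable process: $(Z_t)_{t\ge0}$ is the standard $d$-dimensional rotationally invariant $\alpha$-stable Lévy process, with Lévy measure $\nu(\mathrm{d}z)=C_{d,\alpha}|z|^{-d-\alpha}\,\mathrm{d}z$, where $$C_{d,\alpha}=\alpha 2^{\alpha-1}\pi^{-d/2}\,\frac{\Gamma((d+\alpha)/2)}{\Gamma(1-\alpha/2)}$$ (equivalently $\mathbb{E}\,\mathrm{e}^{i\langle\xi,Z_t\rangle}=\mathrm{e}^{-t|\xi|^\alpha}$). Its transition density $p_\alpha(t,x)$ satisfies, for a constant $K(d,\alpha)\ge1$ depending only on $d$ and $\alpha$ (fixed throughout), $$K(d,\alpha)^{-1}\frac{t}{(t^{1/\alpha}+|x|)^{d+\alpha}}\le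 p_\alpha(t,x)\le K(d,\alpha)\frac{t}{(t^{1/\alpha}+|x|)^{d+\alpha}},\qquad t>0,\ x\in\mathbb{R}^d.$$ Pareto distribution with parameter $\alpha$ on $\mathbb{R}^d$: the distribution with density $p(z)=\dfrac{\alpha}{s_{d-1}|z|^{\alpha+d}}\mathbf 1_{(1,\infty)}(|z|)$, where $s_{d-1}=2\pi^{d/2}/\Gamma(d/2)$ is the surface area of the unit sphere in $\mathbb{R}^d$. Constants: $\sigma>0$ is defined by $\sigma^\alpha=\alpha/(s_{d-1}C_{d,\alpha})$; $\kappa_\alpha=2^\alpha/(2^\alpha-1)$; $\delta_\alpha=\dfrac{2^{d+\alpha}\alpha K(d,\alpha)}{s_{d-1}}\big(1-2^{-\alpha}\big)^{-1}$.
   Formalization: The lower bounds on P(Ω_n) and P(Ω̃_n) are stated for n ≥ 2; for n = 1 only positive probability is claimed, since with c > 1 the printed bound fails at n = 1 (e.g. x_0 = 0, f(x) = |x|x, g = εI with ε small). *)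

theory Defs
  imports "HOL-Probability.Probability"
begin

text \<open>In the usual notation: \<open>sphere_area d\<close> is \<open>s\<^bsub>d-1\<^esub>\<close>, \<open>stable_const d \<alpha>\<close> is \<open>C\<^bsub>d,\<alpha>\<^esub>\<close>,
  \<open>pareto_scale d \<alpha>\<close> is \<open>\<sigma>\<close>.\<close>

definition sphere_area :: "nat \<Rightarrow> real" where
  "sphere_area d = 2 * pi powr (real d / 2) / Gamma (real d / 2)"

definition stable_const :: "nat \<Rightarrow> real \<Rightarrow> real" where
  "stable_const d \<alpha> = \<alpha> * 2 powr (\<alpha> - 1) * pi powr (- real d / 2)
     * Gamma ((real d + \<alpha>) / 2) / Gamma (1 - \<alpha> / 2)"

definition pareto_scale :: "nat \<Rightarrow> real \<Rightarrow> real" where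
  "pareto_scale d \<alpha> = (\<alpha> / (sphere_area d * stable_const d \<alpha>)) powr (1 / \<alpha>)"

lemma pareto_scale_char:
  assumes "d \<ge> 1" "0 < \<alpha>" "\<alpha> < 2"
  shows "pareto_scale d \<alpha> > 0"
    and "pareto_scale d \<alpha> powr \<alpha> = \<alpha> / (sphere_area d * stable_const d \<alpha>)"
proof -
  have "sphere_area d > 0"
    unfolding sphere_area_def using assms by (auto intro!: divide_pos_pos mult_pos_pos Gamma_real_pos)
  moreover have "stable_const d \<alpha> > 0"
    unfolding stable_const_def using assms by (auto intro!: divide_pos_pos mult_pos_pos Gamma_real_pos)
  ultimately have pos: "\<alpha> / (sphere_area d * stable_const d \<alpha>) > 0"
    using assms by simp
  show "pareto_scale d \<alpha> > 0"
    unfolding pareto_scale_def powr_gt_zero using pos by linarith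
  show "pareto_scale d \<alpha> powr \<alpha> = \<alpha> / (sphere_area d * stable_const d \<alpha>)"
    unfolding pareto_scale_def powr_powr using pos assms by (metis less_irrefl nonzero_divide_eq_eq order_less_imp_le powr_one)
qed

definition kappa :: "real \<Rightarrow> real" where
  "kappa \<alpha> = 2 powr \<alpha> / (2 powr \<alpha> - 1)"

definition delta :: "nat \<Rightarrow> real \<Rightarrow> real \<Rightarrow> real" where
  "delta d \<alpha> K = 2 powr (real d + \<alpha>) * \<alpha> * K / sphere_area d * inverse (1 - 2 powr (- \<alpha>))"

definition pareto_density :: "real \<Rightarrow> real ^ 'd \<Rightarrow> real" where
  "pareto_density \<alpha> z =
     \<alpha> / (sphere_area CARD('d) * norm z powr (\<alpha> + real CARD('d))) * indicator {1<..} (norm z)"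

definition iid_pareto :: "'w measure \<Rightarrow> real \<Rightarrow> (nat \<Rightarrow> 'w \<Rightarrow> real ^ 'd) \<Rightarrow> bool" where
  "iid_pareto M \<alpha> X \<longleftrightarrow>
     prob_space.indep_vars M (\<lambda>_. borel) X {1..} \<and>
     (\<forall>k\<ge>1. distributed M lborel (X k) (\<lambda>z. ennreal (pareto_density \<alpha> z)))"

text \<open>Processes are indexed by all reals; only times \<open>t \<ge> 0\<close> are constrained.\<close>

definition cadlag :: "(real \<Rightarrow> 'a::topological_space) \<Rightarrow> bool" where
  "cadlag x \<longleftrightarrow>
     (\<forall>t\<ge>0. (x \<longlongrightarrow> x t) (at_right t)) \<and>
     (\<forall>t>0. \<exists>l. (x \<longlongrightarrow> l) (at_left t))"

text \<open>Stochastic continuity is not listed: it follows from stationarity of the increments and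
  right-continuity of the paths at \<open>0\<close>.\<close>

definition levy_process :: "'w measure \<Rightarrow> (real \<Rightarrow> 'w \<Rightarrow> real ^ 'd) \<Rightarrow> bool" where
  "levy_process M Z \<longleftrightarrow>
     (\<forall>t\<ge>0. Z t \<in> borel_measurable M) \<and>
     (AE \<omega> in M. Z 0 \<omega> = 0) \<and>
     (\<forall>(m::nat) (t :: nat \<Rightarrow> real). 0 \<le> t 0 \<and> (\<forall>i<m. t i \<le> t (Suc i)) \<longrightarrow>
        prob_space.indep_vars M (\<lambda>_. borel) (\<lambda>i \<omega>. Z (t (Suc i)) \<omega> - Z (t i) \<omega>) {..<m}) \<and>
     (\<forall>s\<ge>0. \<forall>t\<ge>0. distr M borel (\<lambda>\<omega>. Z (s + t) \<omega> - Z s \<omega>) = distr M borel (Z t)) \<and>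
     (AE \<omega> in M. cadlag (\<lambda>t. Z t \<omega>))"

text \<open>The density below is \<open>0\<close> at the origin, because \<open>0 powr a = 0\<close>; this is a Lebesgue null set.\<close>

definition stable_levy_measure :: "real \<Rightarrow> (real ^ 'd) measure" where
  "stable_levy_measure \<alpha> =
     density lborel (\<lambda>z. ennreal (stable_const CARD('d) \<alpha> * norm z powr (- real CARD('d) - \<alpha>)))"

text \<open>The Levy process with Levy-Khintchine triplet \<open>(0, \<nu>, 0)\<close> (no Gaussian part, no drift), where
  \<open>\<nu>\<close> is the measure above; equivalently, its characteristic function is
  \<open>exp (- t * norm \<xi> powr \<alpha>)\<close>.\<close>

definition standard_stable_process :: "'w measure \<Rightarrow> real \<Rightarrow> (real \<Rightarrow> 'w \<Rightarrow> real ^ 'd) \<Rightarrow> bool" where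
  "standard_stable_process M \<alpha> Z \<longleftrightarrow>
     levy_process M Z \<and>
     (\<forall>t\<ge>0. \<forall>\<xi>. (LINT \<omega>|M. iexp (\<xi> \<bullet> Z t \<omega>)) =
        exp (complex_of_real t *
          (LINT z|stable_levy_measure \<alpha>.
             iexp (\<xi> \<bullet> z) - 1 - \<i> * complex_of_real ((\<xi> \<bullet> z) * indicator (cball 0 1) z))))"

text \<open>For a Levy process the transition density \<open>p t\<close> is the density of \<open>Z t\<close>.\<close>

definition transition_density ::
    "'w measure \<Rightarrow> (real \<Rightarrow> 'w \<Rightarrow> real ^ 'd) \<Rightarrow> (real \<Rightarrow> real ^ 'd \<Rightarrow> real) \<Rightarrow> bool" where
  "transition_density M Z p \<longleftrightarrow>
     (\<forall>t>0. distributed M lborel (Z t) (\<lambda>x. ennreal (p t x)))"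

definition stable_density_bounds :: "real \<Rightarrow> real \<Rightarrow> (real \<Rightarrow> real ^ 'd \<Rightarrow> real) \<Rightarrow> bool" where
  "stable_density_bounds \<alpha> K p \<longleftrightarrow>
     (\<forall>t>0. \<forall>x.
        inverse K * (t / (t powr (1 / \<alpha>) + norm x) powr (real CARD('d) + \<alpha>)) \<le> p t x \<and>
        p t x \<le> K * (t / (t powr (1 / \<alpha>) + norm x) powr (real CARD('d) + \<alpha>)))"

text \<open>\<open>norm\<close> on matrices is the Frobenius norm, hence the explicit operator norm.\<close>

definition op_norm :: "real ^ 'd ^ 'd \<Rightarrow> real" where
  "op_norm A = onorm (\<lambda>v. A *v v)"

primrec stable_euler ::
    "(real ^ 'd \<Rightarrow> real ^ 'd) \<Rightarrow> (real ^ 'd \<Rightarrow> real ^ 'd ^ 'd) \<Rightarrow> (real \<Rightarrow> 'w \<Rightarrow> real ^ 'd)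
      \<Rightarrow> real ^ 'd \<Rightarrow> real \<Rightarrow> nat \<Rightarrow> 'w \<Rightarrow> real ^ 'd" where
  "stable_euler f g Z x0 \<eta> 0 = (\<lambda>\<omega>. x0)"
| "stable_euler f g Z x0 \<eta> (Suc k) =
     (\<lambda>\<omega>. let y = stable_euler f g Z x0 \<eta> k \<omega> in
        y + \<eta> *\<^sub>R f y + g y *v (Z (real (Suc k) * \<eta>) \<omega> - Z (real k * \<eta>) \<omega>))"

primrec pareto_euler ::
    "real \<Rightarrow> (real ^ 'd \<Rightarrow> real ^ 'd) \<Rightarrow> (real ^ 'd \<Rightarrow> real ^ 'd ^ 'd) \<Rightarrow> (nat \<Rightarrow> 'w \<Rightarrow> real ^ 'd)
      \<Rightarrow> real ^ 'd \<Rightarrow> real \<Rightarrow> nat \<Rightarrow> 'w \<Rightarrow> real ^ 'd" where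
  "pareto_euler \<alpha> f g X x0 \<eta> 0 = (\<lambda>\<omega>. x0)"
| "pareto_euler \<alpha> f g X x0 \<eta> (Suc k) =
     (\<lambda>\<omega>. let y = pareto_euler \<alpha> f g X x0 \<eta> k \<omega> in
        y + \<eta> *\<^sub>R f y
          + (1 / pareto_scale CARD('d) \<alpha> * \<eta> powr (1 / \<alpha>)) *\<^sub>R (g y *v X (Suc k) \<omega>))"

end

theory Submission
  imports Defs "HOL-Real_Asymp.Real_Asymp"
begin

text \<open>
  The schemes explode along rare events whose probability is only exponentially small. Suppose that
  the current iterate \<open>y\<close> is large. One of drift and diffusion is at least of order \<open>\<bar>y\<bar> powr \<gamma>\<close> while
  the other is at most of order \<open>\<bar>y\<bar> powr l\<close> with \<open>l < \<gamma>\<close>, so they cannot cancel, and the next iterate is at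
  least \<open>\<bar>y\<bar> powr l\<close> as soon as the normalised noise \<open>z\<close> satisfies \<open>1 < \<bar>z\<bar> \<le> 2\<close> and is not almost annihilated
  by the diffusion matrix (\<open>euler_step_explodes\<close>). For Pareto noise the annulus has probability
  \<open>1 - 2 powr (- \<alpha>)\<close>, which is the reciprocal of \<open>kappa \<alpha>\<close>.

  Even a degenerate matrix has a direction \<open>w\<close> in which it acts with at least half its norm
  (\<open>op_norm_functional\<close>), and excluding the slab of noise vectors with \<open>\<bar>w \<bullet> z\<bar> < e * \<bar>w\<bar>\<close> costs
  probability at most \<open>C * e\<close> (\<open>measure_pareto_annulus_minus_slab_ge\<close>). With \<open>e\<close> of order \<open>1 / n\<close> the product
  of the resulting factors \<open>1 - 1 / (2 * n)\<close> is bounded below. The powers of \<open>n\<close> lost to the step size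
  and to \<open>e\<close> are harmless if the iterates exceed a threshold \<open>R n\<close> that is polynomial in \<open>n\<close>, because
  \<open>\<gamma> > l\<close> (\<open>explosion_thresholds\<close>). The first step passes this threshold with polynomially small
  probability, by the heavy tail of the noise and \<open>g x0 \<noteq> 0\<close>. Independence of the noise multiplies
  the probabilities of the steps (\<open>noise_chain_prob_ge\<close>), which gives the lower bound
  \<open>A * n powr (- m) * (1 - 2 powr (- \<alpha>)) ^ n\<close> for an event on which the norm is at least
  \<open>R n powr (l ^ (n - 1))\<close>.

  The stable scheme is reduced to the same estimate: by the lower density bound, the law of an
  increment over a step of size \<open>\<eta>\<close>, divided by \<open>\<eta> powr (1 / \<alpha>)\<close>, dominates a fixed multiple of the
  Pareto law (\<open>emeasure_scaled_stable_ge\<close>), and this multiple turns \<open>kappa\<close> into \<open>delta\<close>. The moments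
  diverge because doubly exponential growth on the event outweighs its exponentially small
  probability.
\<close>

section \<open>The Pareto law on Euclidean space\<close>

definition pareto :: "real \<Rightarrow> (real ^ 'd) measure" where
  "pareto \<alpha> = density lborel (\<lambda>z. ennreal (pareto_density \<alpha> z))"

lemma sets_pareto [measurable_cong, simp]: "sets (pareto \<alpha>) = sets borel"
  by (simp add: pareto_def)

lemma space_pareto [simp]: "space (pareto \<alpha>) = UNIV"
  by (simp add: pareto_def)

lemma sphere_area_pos: "d \<ge> 1 \<Longrightarrow> sphere_area d > 0"
  unfolding sphere_area_def by (auto intro!: divide_pos_pos mult_pos_pos Gamma_real_pos)

lemma pareto_density_measurable [measurable]:
  "(pareto_density \<alpha> :: real ^ 'd \<Rightarrow> real) \<in> borel_measurable borel"
  unfolding pareto_density_def by measurable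

lemma pareto_density_eq_0: "norm z \<le> 1 \<Longrightarrow> pareto_density \<alpha> z = 0"
  by (simp add: pareto_density_def)

lemma emeasure_pareto:
  "A \<in> sets borel \<Longrightarrow>
    emeasure (pareto \<alpha>) A = (\<integral>\<^sup>+z. ennreal (pareto_density \<alpha> z) * indicator A z \<partial>lborel)"
  unfolding pareto_def by (rule emeasure_density) auto

lemma nn_integral_lborel_scale:
  fixes h :: "'a::euclidean_space \<Rightarrow> ennreal"
  assumes [measurable]: "h \<in> borel_measurable borel" and "c > 0"
  shows "(\<integral>\<^sup>+z. h z \<partial>lborel) = ennreal (c ^ DIM('a)) * (\<integral>\<^sup>+z. h (c *\<^sub>R z) \<partial>lborel)"
proof -
  have "(\<integral>\<^sup>+z. h z \<partial>lborel)
      = (\<integral>\<^sup>+z. h z \<partial>density (distr lborel borel (\<lambda>x::'a. 0 + c *\<^sub>R x)) (\<lambda>_. ennreal (\<bar>c\<bar>^DIM('a))))"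
    using lborel_affine[of c "0::'a"] assms by simp
  also have "\<dots> = ennreal (c ^ DIM('a)) * (\<integral>\<^sup>+z. h (c *\<^sub>R z) \<partial>lborel)"
    using assms by (simp add: nn_integral_density nn_integral_distr nn_integral_cmult)
  finally show ?thesis .
qed

text \<open>The power law \<open>\<bar>z\<bar> powr (- \<alpha> - d)\<close> is homogeneous and the volume element contributes \<open>s ^ d\<close>, so the
  tail of the law is self-similar. Outside the unit ball the cut-off in the density is invisible to
  both sides, which is why \<open>B\<close> has to avoid that ball and why \<open>s\<close> must not shrink it.\<close>

lemma emeasure_pareto_scale:
  fixes B :: "(real ^ 'd) set"
  assumes [measurable]: "B \<in> sets borel" and B: "B \<subseteq> {z. norm z > 1}" and s: "s \<ge> 1"
  shows "emeasure (pareto \<alpha>) ((\<lambda>z. inverse s *\<^sub>R z) -` B) = ennreal (s powr (-\<alpha>)) * emeasure (pareto \<alpha>) B"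
proof -
  have [measurable]: "(\<lambda>z::real^'d. inverse s *\<^sub>R z) -` B \<in> sets borel"
    by (rule measurable_sets_borel[where M = borel]) auto
  have dens: "s ^ CARD('d) * pareto_density \<alpha> (s *\<^sub>R z) = s powr (-\<alpha>) * pareto_density \<alpha> z" if "z \<in> B" for z
  proof -
    have z: "norm z > 1" using that B by auto
    then have sz: "s * norm z > 1" using mult_right_mono[OF s, of "norm z"] by simp
    have "(s * norm z) powr (\<alpha> + real CARD('d)) = s powr \<alpha> * s ^ CARD('d) * norm z powr (\<alpha> + real CARD('d))"
      using s z by (simp add: powr_mult powr_add powr_realpow)
    then show ?thesis using z sz s
      by (simp add: pareto_density_def powr_minus divide_simps)
  qed
  have "emeasure (pareto \<alpha>) ((\<lambda>z. inverse s *\<^sub>R z) -` B)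
      = (\<integral>\<^sup>+z. ennreal (pareto_density \<alpha> z) * indicator B (inverse s *\<^sub>R z) \<partial>lborel)"
    by (subst emeasure_pareto) (auto intro!: nn_integral_cong split: split_indicator)
  also have "\<dots> = ennreal (s ^ CARD('d)) * (\<integral>\<^sup>+z. ennreal (pareto_density \<alpha> (s *\<^sub>R z)) * indicator B z \<partial>lborel)"
    using s by (subst nn_integral_lborel_scale[where c = s]) auto
  also have "\<dots> = (\<integral>\<^sup>+z. ennreal (s powr (-\<alpha>)) * (ennreal (pareto_density \<alpha> z) * indicator B z) \<partial>lborel)"
    using s dens
    by (subst nn_integral_cmult[symmetric])
       (auto intro!: nn_integral_cong split: split_indicator simp flip: ennreal_mult')
  also have "\<dots> = ennreal (s powr (-\<alpha>)) * emeasure (pareto \<alpha>) B"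
    by (subst nn_integral_cmult) (auto simp: emeasure_pareto)
  finally show ?thesis .
qed

lemma measure_pareto_scale:
  fixes B :: "(real ^ 'd) set"
  assumes "B \<in> sets borel" and "B \<subseteq> {z. norm z > 1}" and "s \<ge> 1"
  shows "measure (pareto \<alpha>) ((\<lambda>z. inverse s *\<^sub>R z) -` B) = s powr (-\<alpha>) * measure (pareto \<alpha>) B"
  using emeasure_pareto_scale[OF assms, of \<alpha>] by (simp add: measure_def enn2real_mult)

text \<open>This number is the reciprocal of \<open>kappa \<alpha>\<close>; it is the price of one explosive step. The total
  mass is assumed rather than computed, so that self-similarity alone yields the value, without
  polar coordinates.\<close>

lemma measure_pareto_annulus:
  assumes "prob_space (pareto \<alpha> :: (real ^ 'd) measure)"
  shows "measure (pareto \<alpha>) {z::real^'d. 1 < norm z \<and> norm z \<le> 2} = 1 - 2 powr (-\<alpha>)"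
proof -
  interpret P: prob_space "pareto \<alpha> :: (real ^ 'd) measure" by fact
  have meas: "{z::real^'d. norm z > r} \<in> sets borel" "{z::real^'d. norm z \<le> r} \<in> sets borel" for r
    by measurable
  have "emeasure (pareto \<alpha>) {z::real^'d. norm z \<le> 1} = 0"
    using meas by (subst emeasure_pareto) (auto simp: nn_integral_0_iff_AE pareto_density_eq_0 split: split_indicator)
  then have "P.prob {z. norm z \<le> 1} = 0"
    by (simp add: measure_def)
  moreover have "{z::real^'d. norm z \<le> 1} = space (pareto \<alpha>) - {z. norm z > 1}" by auto
  ultimately have one: "P.prob {z. norm z > 1} = 1"
    using P.prob_compl[of "{z. norm z > 1}"] meas by simp
  have "P.prob {z. norm z > 2} = P.prob ((\<lambda>z. inverse 2 *\<^sub>R z) -` {z. norm z > 1})"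
    by (rule arg_cong[where f = P.prob]) auto
  also have "\<dots> = 2 powr (-\<alpha>)"
    using one meas by (subst measure_pareto_scale) auto
  finally have two: "P.prob {z. norm z > 2} = 2 powr (-\<alpha>)" .
  have "{z::real^'d. 1 < norm z \<and> norm z \<le> 2} = {z. norm z > 1} - {z. norm z > 2}" by auto
  also have "P.prob \<dots> = P.prob {z. norm z > 1} - P.prob {z. norm z > 2}"
    using meas by (intro P.finite_measure_Diff) auto
  finally show ?thesis by (simp add: one two)
qed

lemma emeasure_lborel_translate:
  fixes S :: "'a::euclidean_space set"
  assumes "S \<in> sets borel"
  shows "emeasure lborel ((\<lambda>z. a + z) -` S) = emeasure lborel S"
proof -
  have "emeasure lborel S = emeasure (distr lborel borel (\<lambda>z. a + z)) S"
    by (simp add: lborel_distr_plus)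
  also have "\<dots> = emeasure lborel ((\<lambda>z. a + z) -` S)"
    using assms by (subst emeasure_distr) auto
  finally show ?thesis ..
qed

text \<open>A packing argument: about \<open>1 / e\<close> translates of the slab by multiples of \<open>2 * e\<close> along its normal
  are disjoint and all lie in the ball of radius \<open>4\<close>. The point is that the bound is linear in the
  thickness and uniform in the direction \<open>w\<close>.\<close>

lemma emeasure_slab_le:
  fixes w :: "'a::euclidean_space"
  assumes w: "w \<noteq> 0" and e: "e > 0"
  shows "emeasure lborel {z. norm z \<le> 2 \<and> \<bar>w \<bullet> z\<bar> < e * norm w}
           \<le> ennreal (e * measure lborel (cball (0::'a) 4))"
proof -
  define u where "u = w /\<^sub>R norm w"
  define S where "S = {z. norm z \<le> 2 \<and> \<bar>u \<bullet> z\<bar> < e}"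
  define S' where "S' k = (\<lambda>z. (- (2 * real k * e)) *\<^sub>R u + z) -` S" for k
  define N where "N = nat \<lceil>1 / e\<rceil>"
  have u: "norm u = 1" using w by (simp add: u_def)
  then have uu: "u \<bullet> u = 1" by (simp add: norm_eq_1)
  have S_eq: "{z. norm z \<le> 2 \<and> \<bar>w \<bullet> z\<bar> < e * norm w} = S"
    using w by (auto simp: S_def u_def abs_mult divide_simps)
  have [measurable]: "S \<in> sets borel" unfolding S_def by measurable
  have S'm: "S' k \<in> sets borel" for k
    unfolding S'_def by (rule measurable_sets_borel[where M = borel]) auto
  have "disjoint_family_on S' {..<N}"
  proof -
    have "False" if "z \<in> S' j" "z \<in> S' k" "j < k" for j k z
    proof -
      have "\<bar>u \<bullet> z - 2 * real j * e\<bar> < e" "\<bar>u \<bullet> z - 2 * real k * e\<bar> < e"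
        using that uu by (simp_all add: S'_def S_def inner_add_right algebra_simps)
      then have "2 * real k * e - 2 * real j * e < 2 * e" by linarith
      then have "(real k - real j) * (2 * e) < 1 * (2 * e)" by (simp add: algebra_simps)
      then have "real k - real j < 1" using e by (simp only: mult_less_cancel_right)
      then show False using \<open>j < k\<close> by linarith
    qed
    then show ?thesis unfolding disjoint_family_on_def
      by (metis disjoint_iff linorder_neqE_nat)
  qed
  then have "(\<Sum>k<N. emeasure lborel (S' k)) = emeasure lborel (\<Union>k<N. S' k)"
    using S'm by (intro sum_emeasure) auto
  also have "\<dots> \<le> emeasure lborel (cball (0::'a) 4)"
  proof (intro emeasure_mono)
    show "(\<Union>k<N. S' k) \<subseteq> cball 0 4"
    proof safe
      fix k z assume k: "k < N" and z: "z \<in> S' k"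
      have "real k < 1 / e" using k by (simp add: N_def) linarith
      then have ke: "real k * e < 1" using e by (simp add: field_simps)
      have "norm z = norm ((2 * real k * e) *\<^sub>R u + ((- (2 * real k * e)) *\<^sub>R u + z))" by simp
      also have "\<dots> \<le> norm ((2 * real k * e) *\<^sub>R u) + norm ((- (2 * real k * e)) *\<^sub>R u + z)"
        by (rule norm_triangle_ineq)
      also have "\<dots> \<le> 2 + 2"
        using z ke e u by (intro add_mono) (auto simp: S'_def S_def)
      finally show "z \<in> cball 0 4" by simp
    qed
  qed auto
  also have "(\<Sum>k<N. emeasure lborel (S' k)) = of_nat N * emeasure lborel S"
    unfolding S'_def by (subst emeasure_lborel_translate) auto
  finally have "of_nat N * emeasure lborel S \<le> emeasure lborel (cball (0::'a) 4)" .
  moreover have cb: "emeasure lborel (cball (0::'a) 4) = ennreal (measure lborel (cball (0::'a) 4))"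
    using emeasure_lborel_cball_finite[of "0::'a" 4] by (intro emeasure_eq_ennreal_measure) (simp add: less_top)
  moreover have "ennreal (1/e) \<le> of_nat N"
    unfolding N_def by (subst ennreal_of_nat_eq_real_of_nat) (intro ennreal_leI, linarith)
  ultimately have "ennreal (1/e) * emeasure lborel S \<le> ennreal (measure lborel (cball (0::'a) 4))"
    by (metis mult_right_mono order_trans zero_le)
  then have "ennreal e * (ennreal (1/e) * emeasure lborel S) \<le> ennreal e * ennreal (measure lborel (cball (0::'a) 4))"
    by (rule mult_left_mono) simp
  then show ?thesis unfolding S_eq
    using e by (simp add: mult.assoc[symmetric] ennreal_mult'[symmetric])
qed

lemma measure_pareto_slab_le:
  assumes "0 < \<alpha>"
  obtains C where "C \<ge> 1"
    "\<And>(w :: real ^ 'd) e. w \<noteq> 0 \<Longrightarrow> e > 0 \<Longrightarrow>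
       measure (pareto \<alpha>) {z. (1 < norm z \<and> norm z \<le> 2) \<and> \<bar>w \<bullet> z\<bar> < e * norm w} \<le> C * e"
proof -
  define a where "a = \<alpha> / sphere_area CARD('d)"
  define v where "v = measure lborel (cball (0::real^'d) 4)"
  have sp: "sphere_area CARD('d) > 0" by (rule sphere_area_pos) simp
  then have a: "a > 0" using assms by (simp add: a_def)
  have v: "v \<ge> 0" by (simp add: v_def)
  have dens: "pareto_density \<alpha> (z::real^'d) \<le> a" for z
  proof (cases "norm z > 1")
    case True
    then have "norm z powr (\<alpha> + real CARD('d)) \<ge> 1"
      using assms by (intro ge_one_powr_ge_zero) auto
    then have "\<alpha> / (sphere_area CARD('d) * norm z powr (\<alpha> + real CARD('d)))
        \<le> \<alpha> / (sphere_area CARD('d) * 1)"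
      using sp assms by (intro divide_left_mono mult_left_mono mult_pos_pos) auto
    then show ?thesis using True by (simp add: pareto_density_def a_def)
  next
    case False
    then show ?thesis using a by (simp add: pareto_density_def)
  qed
  show ?thesis
  proof (rule that[of "max 1 (a * v)"])
    fix w :: "real^'d" and e :: real assume w: "w \<noteq> 0" and e: "e > 0"
    define S where "S = {z. norm z \<le> 2 \<and> \<bar>w \<bullet> z\<bar> < e * norm w}"
    define S1 where "S1 = {z. (1 < norm z \<and> norm z \<le> 2) \<and> \<bar>w \<bullet> z\<bar> < e * norm w}"
    have [measurable]: "S \<in> sets borel" "S1 \<in> sets borel" unfolding S_def S1_def by measurable
    have "emeasure (pareto \<alpha>) S1 \<le> (\<integral>\<^sup>+z. ennreal a * indicator S z \<partial>lborel)"
      using dens by (subst emeasure_pareto)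
        (auto intro!: nn_integral_mono ennreal_leI simp: S_def S1_def split: split_indicator)
    also have "\<dots> = ennreal a * emeasure lborel S"
      by (simp add: nn_integral_cmult_indicator)
    also have "\<dots> \<le> ennreal a * ennreal (e * v)"
      unfolding S_def v_def using emeasure_slab_le[OF w e] by (intro mult_left_mono) auto
    also have "\<dots> = ennreal (a * v * e)"
      using a by (simp add: ennreal_mult' mult_ac flip: ennreal_mult'')
    finally have "measure (pareto \<alpha>) S1 \<le> a * v * e"
      using a v e by (simp add: measure_def enn2real_leI)
    also have "\<dots> \<le> max 1 (a * v) * e" using e by (intro mult_right_mono) auto
    finally show "measure (pareto \<alpha>) S1 \<le> max 1 (a * v) * e" .
  qed simp
qed

text \<open>A noise vector may be almost annihilated by a degenerate diffusion matrix. Excluding the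
  vectors with this defect from the annulus costs only \<open>C * e\<close>, so a width \<open>e\<close> of order \<open>1 / n\<close> costs a bounded factor
  over \<open>n\<close> steps.\<close>

lemma measure_pareto_annulus_minus_slab_ge:
  assumes "prob_space (pareto \<alpha> :: (real ^ 'd) measure)" and "0 < \<alpha>"
  obtains C where "C \<ge> 1"
    "\<And>(w :: real ^ 'd) e. w \<noteq> 0 \<Longrightarrow> e > 0 \<Longrightarrow>
       measure (pareto \<alpha>) {z. (1 < norm z \<and> norm z \<le> 2) \<and> e * norm w \<le> \<bar>w \<bullet> z\<bar>}
         \<ge> 1 - 2 powr (-\<alpha>) - C * e"
proof -
  interpret P: prob_space "pareto \<alpha> :: (real ^ 'd) measure" by fact
  obtain C where C: "C \<ge> 1" "\<And>(w :: real ^ 'd) e. w \<noteq> 0 \<Longrightarrow> e > 0 \<Longrightarrow>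
       P.prob {z. (1 < norm z \<and> norm z \<le> 2) \<and> \<bar>w \<bullet> z\<bar> < e * norm w} \<le> C * e"
    by (rule measure_pareto_slab_le[OF assms(2)]) blast
  show ?thesis
  proof (rule that[OF C(1)])
    fix w :: "real^'d" and e :: real assume "w \<noteq> 0" "e > 0"
    note C(2)[OF this]
    moreover have "{z. (1 < norm z \<and> norm z \<le> 2) \<and> e * norm w \<le> \<bar>w \<bullet> z\<bar>}
      = {z. 1 < norm z \<and> norm z \<le> 2} - {z. (1 < norm z \<and> norm z \<le> 2) \<and> \<bar>w \<bullet> z\<bar> < e * norm w}"
      by auto
    moreover have "P.prob ({z. 1 < norm z \<and> norm z \<le> 2} - {z. (1 < norm z \<and> norm z \<le> 2) \<and> \<bar>w \<bullet> z\<bar> < e * norm w})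
      = P.prob {z. 1 < norm z \<and> norm z \<le> 2} - P.prob {z. (1 < norm z \<and> norm z \<le> 2) \<and> \<bar>w \<bullet> z\<bar> < e * norm w}"
      by (rule P.finite_measure_Diff) auto
    ultimately show "P.prob {z. (1 < norm z \<and> norm z \<le> 2) \<and> e * norm w \<le> \<bar>w \<bullet> z\<bar>}
         \<ge> 1 - 2 powr (-\<alpha>) - C * e"
      by (simp add: measure_pareto_annulus[OF assms(1)])
  qed
qed

text \<open>The heavy tail in any fixed direction: scale the good part of the annulus, with a width \<open>e\<close> that
  is kept fixed, by the factor \<open>L / e\<close>.\<close>

lemma measure_pareto_far_ge:
  assumes prob: "prob_space (pareto \<alpha> :: (real ^ 'd) measure)" and "0 < \<alpha>"
  obtains c where "c > 0"
    "\<And>(w :: real ^ 'd) L. w \<noteq> 0 \<Longrightarrow> L \<ge> 1 \<Longrightarrow>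
       measure (pareto \<alpha>) {z. L * norm w \<le> \<bar>w \<bullet> z\<bar>} \<ge> c * L powr (-\<alpha>)"
proof -
  interpret P: prob_space "pareto \<alpha> :: (real ^ 'd) measure" by fact
  define \<rho> where "\<rho> = 1 - 2 powr (-\<alpha>)"
  have \<rho>: "\<rho> > 0" "\<rho> < 1" using assms by (simp_all add: \<rho>_def powr_less_one)
  obtain C where C: "C \<ge> 1" "\<And>(w :: real ^ 'd) e. w \<noteq> 0 \<Longrightarrow> e > 0 \<Longrightarrow>
       P.prob {z. (1 < norm z \<and> norm z \<le> 2) \<and> e * norm w \<le> \<bar>w \<bullet> z\<bar>} \<ge> \<rho> - C * e"
    unfolding \<rho>_def by (rule measure_pareto_annulus_minus_slab_ge[OF assms]) blast
  define e where "e = \<rho> / (2 * C)"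
  have e: "e > 0" "e \<le> 1" using \<rho> C by (auto simp: e_def divide_simps)
  show ?thesis
  proof (rule that[of "\<rho> / 2 * e powr \<alpha>"])
    fix w :: "real^'d" and L :: real assume w: "w \<noteq> 0" and L: "L \<ge> 1"
    define G where "G = {z. (1 < norm z \<and> norm z \<le> 2) \<and> e * norm w \<le> \<bar>w \<bullet> z\<bar>}"
    have Gm: "G \<in> sets borel" unfolding G_def by measurable
    have "P.prob G \<ge> \<rho> - C * e" unfolding G_def by (rule C) (use w e in auto)
    then have PG: "P.prob G \<ge> \<rho> / 2" using C by (simp add: e_def)
    have s: "L / e \<ge> 1" using L e by (simp add: divide_simps)
    have "\<rho> / 2 * e powr \<alpha> * L powr (-\<alpha>) = (L / e) powr (-\<alpha>) * (\<rho> / 2)"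
      using L e by (simp add: powr_divide powr_minus divide_simps)
    also have "\<dots> \<le> (L / e) powr (-\<alpha>) * P.prob G" using PG by (intro mult_left_mono) auto
    also have "\<dots> = P.prob ((\<lambda>z. inverse (L / e) *\<^sub>R z) -` G)"
      using Gm s by (subst measure_pareto_scale) (auto simp: G_def)
    also have "\<dots> \<le> P.prob {z. L * norm w \<le> \<bar>w \<bullet> z\<bar>}"
    proof (rule P.finite_measure_mono)
      show "(\<lambda>z. inverse (L / e) *\<^sub>R z) -` G \<subseteq> {z. L * norm w \<le> \<bar>w \<bullet> z\<bar>}"
        using L e by (auto simp: G_def abs_mult divide_simps mult_ac)
    qed auto
    finally show "P.prob {z. L * norm w \<le> \<bar>w \<bullet> z\<bar>} \<ge> \<rho> / 2 * e powr \<alpha> * L powr (-\<alpha>)" .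
  qed (use \<rho> e in auto)
qed

section \<open>Explosion of a single Euler step\<close>

lemma op_norm_nonneg: "op_norm A \<ge> 0"
  unfolding op_norm_def by (rule onorm_pos_le) (rule matrix_vector_mul_bounded_linear)

lemma norm_matrix_vector_le: "norm (A *v z) \<le> op_norm A * norm z"
  unfolding op_norm_def by (rule onorm) (rule matrix_vector_mul_bounded_linear)

lemma op_norm_eq_0_iff: "op_norm A = 0 \<longleftrightarrow> A = 0"
  unfolding op_norm_def
  by (subst onorm_eq_0[OF matrix_vector_mul_bounded_linear])
     (metis matrix_eq matrix_vector_mult_0)

text \<open>The vector \<open>w\<close> is the transpose of \<open>A\<close> applied to the unit vector along \<open>A *v v\<close>, where \<open>v\<close> is a vector that
  \<open>A\<close> stretches by more than half its norm. It turns lower bounds for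
  \<open>norm (A *v z)\<close> into conditions that involve a single direction.\<close>

lemma op_norm_functional:
  fixes A :: "real ^ 'd ^ 'd"
  obtains w where "op_norm A \<le> 2 * norm w" "\<And>z. \<bar>w \<bullet> z\<bar> \<le> norm (A *v z)"
proof (cases "op_norm A = 0")
  case True
  show ?thesis by (rule that[of 0]) (simp_all add: True)
next
  case False
  then have pos: "op_norm A > 0" using op_norm_nonneg[of A] by simp
  have "\<exists>v. norm (A *v v) > op_norm A / 2 * norm v"
  proof (rule ccontr)
    assume "\<not> ?thesis"
    then have "op_norm A \<le> op_norm A / 2"
      unfolding op_norm_def using pos
      by (intro onorm_bound) (auto simp: not_less op_norm_def)
    then show False using pos by simp
  qed
  then obtain v where v: "norm (A *v v) > op_norm A / 2 * norm v" by blast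
  define u where "u = (A *v v) /\<^sub>R norm (A *v v)"
  have Av: "norm (A *v v) > 0"
    using v pos by (smt (verit) mult_nonneg_nonneg norm_ge_zero divide_nonneg_nonneg)
  then have u: "norm u = 1" by (simp add: u_def)
  have "v \<noteq> 0" using Av by auto
  show ?thesis
  proof (rule that[of "u v* A"])
    have "norm (A *v v) = u \<bullet> (A *v v)"
      using Av by (simp add: u_def power2_norm_eq_inner[symmetric] power2_eq_square)
    also have "\<dots> = (u v* A) \<bullet> v" by (simp add: dot_lmul_matrix)
    also have "\<dots> \<le> norm (u v* A) * norm v" by (rule norm_cauchy_schwarz)
    finally have "op_norm A / 2 * norm v < norm (u v* A) * norm v" using v by linarith
    then show "op_norm A \<le> 2 * norm (u v* A)" using \<open>v \<noteq> 0\<close> by (simp add: mult_less_cancel_right)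
    show "\<bar>(u v* A) \<bullet> z\<bar> \<le> norm (A *v z)" for z
      using Cauchy_Schwarz_ineq2[of u "A *v z"] u by (simp add: dot_lmul_matrix)
  qed
qed

definition euler_step ::
    "(real ^ 'd \<Rightarrow> real ^ 'd) \<Rightarrow> (real ^ 'd \<Rightarrow> real ^ 'd ^ 'd) \<Rightarrow> real \<Rightarrow> real
      \<Rightarrow> real ^ 'd \<Rightarrow> real ^ 'd \<Rightarrow> real ^ 'd" where
  "euler_step f g a b y z = y + a *\<^sub>R f y + b *\<^sub>R (g y *v z)"

lemma bounded_bilinear_matrix_vector:
  "bounded_bilinear ((*v) :: real ^ 'n ^ 'm \<Rightarrow> real ^ 'n \<Rightarrow> real ^ 'm)"
proof -
  have "bilinear ((*v) :: real ^ 'n ^ 'm \<Rightarrow> real ^ 'n \<Rightarrow> real ^ 'm)"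
    unfolding bilinear_def
    by (auto intro!: linearI simp: matrix_vector_right_distrib matrix_vector_mult_add_rdistrib
        scaleR_matrix_vector_assoc matrix_vector_mult_scaleR)
  then show ?thesis by (simp add: bilinear_conv_bounded_bilinear)
qed

lemma borel_measurable_matrix_vector [measurable (raw)]:
  fixes A :: "'a \<Rightarrow> real ^ 'n ^ 'm"
  assumes "A \<in> borel_measurable M" "v \<in> borel_measurable M"
  shows "(\<lambda>x. A x *v v x) \<in> borel_measurable M"
  using assms by (rule borel_measurable_continuous_Pair)
    (intro bounded_bilinear.continuous_on[OF bounded_bilinear_matrix_vector] continuous_intros)

lemma euler_step_measurable [measurable]:
  fixes f :: "real ^ 'd \<Rightarrow> real ^ 'd"
  assumes [measurable]: "f \<in> borel_measurable borel" "g \<in> borel_measurable borel"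
  shows "(\<lambda>(y, z). euler_step f g a b y z) \<in> borel_measurable (borel \<Otimes>\<^sub>M borel)"
  unfolding euler_step_def case_prod_beta by measurable

text \<open>Of drift and noise one is at least \<open>\<bar>y\<bar> powr \<gamma> / H\<close> and the other at most \<open>H * \<bar>y\<bar> powr l\<close>. Even
  after multiplication with its small factor, \<open>a\<close> for the drift and \<open>b * e\<close> for the diffusion, the large
  one exceeds all other contributions by \<open>\<bar>y\<bar> powr l\<close>, so that they cannot cancel. The hypothesis
  \<open>noise\<close> serves the case of a dominant diffusion and \<open>drift\<close> that of a dominant drift.\<close>

lemma euler_step_explodes:
  assumes y: "norm y \<ge> 1" and l: "l \<ge> 1" and H: "H \<ge> 1" and ab: "a \<ge> 0" "b \<ge> 0"
    and big: "max (norm (f y)) (op_norm (g y)) \<ge> 1 / H * norm y powr \<gamma>"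
    and small: "min (norm (f y)) (op_norm (g y)) \<le> H * norm y powr l"
    and z: "norm z \<le> 2" "e * op_norm (g y) \<le> norm (g y *v z)" "e \<ge> 0"
    and noise: "b * e * norm y powr (\<gamma> - l) \<ge> H * (2 + a * H)"
    and drift: "a * norm y powr (\<gamma> - l) \<ge> H * (2 + 2 * b * H)"
  shows "norm (euler_step f g a b y z) \<ge> norm y powr l"
proof -
  define P where "P = norm y powr l"
  define Q where "Q = norm y powr (\<gamma> - l)"
  have yP: "norm y \<le> P"
    using powr_mono[OF l y] y by (simp add: P_def)
  have P: "P > 0" using yP y by linarith
  have QP: "norm y powr \<gamma> = Q * P" by (simp add: Q_def P_def flip: powr_add)
  \<comment> \<open>The reverse triangle inequality, with either term as the dominant one.\<close>
  have ge: "norm (euler_step f g a b y z) \<ge> b * norm (g y *v z) - norm y - a * norm (f y)"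
    "norm (euler_step f g a b y z) \<ge> a * norm (f y) - norm y - b * norm (g y *v z)"
  proof -
    have tri: "norm (p + q + r) \<ge> norm r - norm p - norm q" "norm (p + q + r) \<ge> norm q - norm p - norm r"
      for p q r :: "real ^ 'a"
      using norm_triangle_ineq4[of "p + q + r" "p + q"] norm_triangle_ineq[of p q]
        norm_triangle_ineq4[of "p + q + r" "p + r"] norm_triangle_ineq[of p r]
      by (simp_all add: algebra_simps)
    show "norm (euler_step f g a b y z) \<ge> b * norm (g y *v z) - norm y - a * norm (f y)"
      "norm (euler_step f g a b y z) \<ge> a * norm (f y) - norm y - b * norm (g y *v z)"
      using tri[where p = y and q = "a *\<^sub>R f y" and r = "b *\<^sub>R (g y *v z)"] ab
      unfolding euler_step_def by simp_all
  qed
  show ?thesis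
  proof (cases "op_norm (g y) \<ge> norm (f y)")
    case True
    then have g: "op_norm (g y) \<ge> Q * P / H" and f: "norm (f y) \<le> H * P"
      using big small by (simp_all add: QP P_def max_def min_def split: if_splits)
    have "(2 + a * H) * P = H * (2 + a * H) * P / H" using H by simp
    also have "\<dots> \<le> b * e * Q * P / H"
      using noise H P by (intro divide_right_mono mult_right_mono) (auto simp: Q_def)
    also have "\<dots> = b * e * (Q * P / H)" by simp
    also have "\<dots> \<le> b * e * op_norm (g y)" using g ab z by (intro mult_left_mono) auto
    also have "\<dots> \<le> b * norm (g y *v z)" using z ab by (simp add: mult.assoc mult_left_mono)
    finally have "b * norm (g y *v z) \<ge> (2 + a * H) * P" .
    moreover have "a * norm (f y) \<le> a * H * P" using f ab by (simp add: mult.assoc mult_left_mono)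
    ultimately show ?thesis using ge(1) yP unfolding P_def[symmetric]
      by (simp add: algebra_simps)
  next
    case False
    then have f: "norm (f y) \<ge> Q * P / H" and g: "op_norm (g y) \<le> H * P"
      using big small by (simp_all add: QP P_def max_def min_def split: if_splits)
    have "(2 + 2 * b * H) * P = H * (2 + 2 * b * H) * P / H" using H by simp
    also have "\<dots> \<le> a * Q * P / H"
      using drift H P by (intro divide_right_mono mult_right_mono) (auto simp: Q_def)
    also have "\<dots> = a * (Q * P / H)" by simp
    also have "\<dots> \<le> a * norm (f y)" using f ab by (intro mult_left_mono) auto
    finally have "a * norm (f y) \<ge> (2 + 2 * b * H) * P" .
    moreover have "norm (g y *v z) \<le> (H * P) * 2"
      using norm_matrix_vector_le[of "g y" z] mult_mono[OF g z(1)] H P by (simp add: mult_ac)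
    then have "b * norm (g y *v z) \<le> b * ((H * P) * 2)" using ab by (intro mult_left_mono)
    ultimately show ?thesis using ge(2) yP unfolding P_def[symmetric]
      by (simp add: algebra_simps)
  qed
qed

section \<open>Markov chains driven by independent noise\<close>

text \<open>The Markov property of a chain driven by independent noise: the lower bound \<open>q\<close> for each frozen
  state \<open>y\<close> is integrated against the law of \<open>Y\<close>, which is possible because the joint law of \<open>Y\<close> and
  \<open>X\<close> is a product.\<close>

lemma (in prob_space) markov_step_prob_ge:
  assumes ind: "indep_var borel Y borel X"
    and [measurable]: "B \<in> sets (borel \<Otimes>\<^sub>M borel)" and S [measurable]: "S \<in> sets borel"
    and q: "\<And>y. y \<in> S \<Longrightarrow> prob (X -` {z. (y, z) \<in> B} \<inter> space M) \<ge> q"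
  shows "prob {\<omega> \<in> space M. Y \<omega> \<in> S \<and> (Y \<omega>, X \<omega>) \<in> B} \<ge> q * prob {\<omega> \<in> space M. Y \<omega> \<in> S}"
proof (cases "q \<ge> 0")
  case q0: True
  have rv [measurable]: "Y \<in> borel_measurable M" "X \<in> borel_measurable M"
    using indep_var_rv1[OF ind] indep_var_rv2[OF ind] by auto
  define B' where "B' = (S \<times> UNIV) \<inter> B"
  have B' [measurable]: "B' \<in> sets (borel \<Otimes>\<^sub>M borel)" unfolding B'_def by measurable
  interpret X: prob_space "distr M borel X" by (rule prob_space_distr) simp
  have slice: "{z. (y, z) \<in> B} \<in> sets borel" for y
    using sets_Pair1[of B borel borel y] by (simp add: vimage_def)
  have "emeasure M {\<omega> \<in> space M. Y \<omega> \<in> S \<and> (Y \<omega>, X \<omega>) \<in> B}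
      = emeasure (distr M (borel \<Otimes>\<^sub>M borel) (\<lambda>x. (Y x, X x))) B'"
    by (subst emeasure_distr) (auto simp: B'_def intro!: arg_cong[where f = "emeasure M"])
  also have "\<dots> = emeasure (distr M borel Y \<Otimes>\<^sub>M distr M borel X) B'"
    using ind by (simp add: indep_var_distribution_eq)
  also have "\<dots> = (\<integral>\<^sup>+y. emeasure (distr M borel X) (Pair y -` B') \<partial>distr M borel Y)"
    by (rule X.emeasure_pair_measure_alt) (simp cong: sets_pair_measure_cong)
  also have "\<dots> \<ge> (\<integral>\<^sup>+y. ennreal q * indicator S y \<partial>distr M borel Y)"
  proof (intro nn_integral_mono)
    fix y
    show "ennreal q * indicator S y \<le> emeasure (distr M borel X) (Pair y -` B')"
    proof (cases "y \<in> S")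
      case True
      then have "Pair y -` B' = {z. (y, z) \<in> B}" by (auto simp: B'_def)
      moreover have "emeasure (distr M borel X) {z. (y, z) \<in> B} = prob (X -` {z. (y, z) \<in> B} \<inter> space M)"
        using slice by (simp add: emeasure_distr emeasure_eq_measure)
      ultimately show ?thesis using q[OF True] True by (simp add: ennreal_leI)
    qed simp
  qed
  also have "(\<integral>\<^sup>+y. ennreal q * indicator S y \<partial>distr M borel Y)
      = ennreal q * emeasure M {\<omega> \<in> space M. Y \<omega> \<in> S}"
    by (subst nn_integral_cmult_indicator)
       (auto simp: emeasure_distr intro!: arg_cong2[where f = "(*)"] arg_cong[where f = "emeasure M"])
  finally show ?thesis
    using q0 by (simp add: emeasure_eq_measure flip: ennreal_mult')
next
  case False
  then have "q * prob {\<omega> \<in> space M. Y \<omega> \<in> S} \<le> 0" by (simp add: mult_nonpos_nonneg)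
  then show ?thesis using measure_nonneg order_trans by blast
qed

primrec noise_chain :: "('a \<Rightarrow> 'b \<Rightarrow> 'a) \<Rightarrow> 'a \<Rightarrow> (nat \<Rightarrow> 'b) \<Rightarrow> nat \<Rightarrow> 'a" where
  "noise_chain F x0 z 0 = x0"
| "noise_chain F x0 z (Suc k) = F (noise_chain F x0 z k) (z k)"

lemma noise_chain_cong:
  "(\<And>i. i < k \<Longrightarrow> z i = z' i) \<Longrightarrow> noise_chain F x0 z k = noise_chain F x0 z' k"
  by (induction k) auto

lemma noise_chain_measurable:
  assumes F: "(\<lambda>(y, z). F y z) \<in> measurable (N \<Otimes>\<^sub>M N') N" and "x0 \<in> space N"
    and z: "\<And>i. i < k \<Longrightarrow> (\<lambda>\<omega>. z \<omega> i) \<in> measurable M N'"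
  shows "(\<lambda>\<omega>. noise_chain F x0 (z \<omega>) k) \<in> measurable M N"
  using z
proof (induction k)
  case 0
  then show ?case using assms by simp
next
  case (Suc k)
  have "(\<lambda>\<omega>. (\<lambda>(y, z). F y z) (noise_chain F x0 (z \<omega>) k, z \<omega> k)) \<in> measurable M N"
    by (rule measurable_compose[OF measurable_Pair F]) (use Suc in auto)
  then show ?case by simp
qed

lemma (in prob_space) noise_chain_indep:
  fixes \<xi> :: "nat \<Rightarrow> 'a \<Rightarrow> 'b::second_countable_topology"
  assumes ind: "indep_vars (\<lambda>_. borel) \<xi> {..<n}" and k: "k < n"
    and F: "(\<lambda>(y, z). F y z) \<in> borel_measurable (borel \<Otimes>\<^sub>M borel)"
  shows "indep_var borel (\<lambda>\<omega>. noise_chain F x0 (\<lambda>i. \<xi> i \<omega>) k) borel (\<xi> k)"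
proof -
  have "indep_var
    borel ((\<lambda>z. noise_chain F x0 z k) \<circ> (\<lambda>\<omega>. restrict (\<lambda>i. \<xi> i \<omega>) {..<k}))
    borel ((\<lambda>z. z k) \<circ> (\<lambda>\<omega>. restrict (\<lambda>i. \<xi> i \<omega>) {k}))"
    using k by (intro indep_var_compose[OF indep_var_restrict[OF ind]] noise_chain_measurable[OF F]) auto
  also have "(\<lambda>z. noise_chain F x0 z k) \<circ> (\<lambda>\<omega>. restrict (\<lambda>i. \<xi> i \<omega>) {..<k})
      = (\<lambda>\<omega>. noise_chain F x0 (\<lambda>i. \<xi> i \<omega>) k)"
    by (auto simp: fun_eq_iff intro!: noise_chain_cong)
  also have "(\<lambda>z. z k) \<circ> (\<lambda>\<omega>. restrict (\<lambda>i. \<xi> i \<omega>) {k}) = \<xi> k" by auto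
  finally show ?thesis .
qed

text \<open>Raising the norm to the power \<open>l\<close> in each step compounds to the exponent \<open>l ^ k\<close>. The chain never
  falls below \<open>R\<close> on the event in question, so the bound \<open>q\<close> is available in every step.\<close>

lemma (in prob_space) noise_chain_prob_ge:
  fixes \<xi> :: "nat \<Rightarrow> 'a \<Rightarrow> real ^ 'd" and F :: "real ^ 'd \<Rightarrow> real ^ 'd \<Rightarrow> real ^ 'd"
  assumes ind: "indep_vars (\<lambda>_. borel) \<xi> {..<n}"
    and F: "(\<lambda>(y, z). F y z) \<in> borel_measurable (borel \<Otimes>\<^sub>M borel)"
    and R: "R \<ge> 1" and l: "l \<ge> 1" and q: "q \<ge> 0"
    and start: "prob (\<xi> 0 -` {z. norm (F x0 z) \<ge> R} \<inter> space M) \<ge> p"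
    and step: "\<And>k y. k < n \<Longrightarrow> norm y \<ge> R \<Longrightarrow>
        prob (\<xi> k -` {z. norm (F y z) \<ge> norm y powr l} \<inter> space M) \<ge> q"
    and k: "k < n"
  shows "prob {\<omega> \<in> space M. norm (noise_chain F x0 (\<lambda>i. \<xi> i \<omega>) (Suc k)) \<ge> R powr (l ^ k)} \<ge> p * q ^ k"
  using k
proof (induction k)
  case 0
  then show ?case using start R by (simp add: vimage_def Int_def conj_commute)
next
  case (Suc k)
  let ?Y = "\<lambda>k \<omega>. noise_chain F x0 (\<lambda>i. \<xi> i \<omega>) k"
  define S :: "(real ^ 'd) set" where "S = {y. norm y \<ge> R powr (l ^ k)}"
  define B where "B = {(y, z). norm (F y z) \<ge> norm y powr l}"
  have [measurable]: "S \<in> sets borel" unfolding S_def by measurable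
  note F [measurable]
  have Bm: "B \<in> sets (borel \<Otimes>\<^sub>M borel)"
  proof -
    have "{x \<in> space (borel \<Otimes>\<^sub>M borel). norm (case x of (y, z) \<Rightarrow> F y z) \<ge> norm (fst x) powr l}
        \<in> sets (borel \<Otimes>\<^sub>M borel)"
      by measurable
    then show ?thesis by (simp add: B_def case_prod_unfold space_pair_measure)
  qed
  have ind': "indep_var borel (?Y (Suc k)) borel (\<xi> (Suc k))"
    using Suc.prems by (intro noise_chain_indep[OF ind] F)
  have rv [measurable]: "?Y (Suc k) \<in> borel_measurable M" "\<xi> (Suc k) \<in> borel_measurable M"
    using indep_var_rv1[OF ind'] indep_var_rv2[OF ind'] by auto
  have SR: "norm y \<ge> R" if "y \<in> S" for y
    using that powr_mono[of 1 "l ^ k" R] R l by (simp add: S_def one_le_power)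
  have "p * q ^ Suc k = q * (p * q ^ k)" by simp
  also have "\<dots> \<le> q * prob {\<omega> \<in> space M. ?Y (Suc k) \<omega> \<in> S}"
    using Suc q by (intro mult_left_mono) (simp_all add: S_def del: noise_chain.simps)
  also have "\<dots> \<le> prob {\<omega> \<in> space M. ?Y (Suc k) \<omega> \<in> S \<and> (?Y (Suc k) \<omega>, \<xi> (Suc k) \<omega>) \<in> B}"
    using step[OF Suc.prems SR] by (intro markov_step_prob_ge[OF ind' Bm]) (auto simp: B_def)
  also have "\<dots> \<le> prob {\<omega> \<in> space M. norm (?Y (Suc (Suc k)) \<omega>) \<ge> R powr (l ^ Suc k)}"
  proof (rule finite_measure_mono)
    have "R powr (l ^ Suc k) \<le> norm (F y z)" if "y \<in> S" "(y, z) \<in> B" for y z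
    proof -
      have "R powr (l ^ Suc k) = (R powr (l ^ k)) powr l" by (simp add: powr_powr mult.commute)
      also have "\<dots> \<le> norm y powr l" using that l by (intro powr_mono2) (auto simp: S_def)
      finally show ?thesis using that by (simp add: B_def)
    qed
    then show "{\<omega> \<in> space M. ?Y (Suc k) \<omega> \<in> S \<and> (?Y (Suc k) \<omega>, \<xi> (Suc k) \<omega>) \<in> B}
        \<subseteq> {\<omega> \<in> space M. norm (?Y (Suc (Suc k)) \<omega>) \<ge> R powr (l ^ Suc k)}"
      by (subst noise_chain.simps(2)) blast
    have [measurable]: "?Y (Suc (Suc k)) \<in> borel_measurable M"
      by (rule noise_chain_measurable[OF F]) (use ind Suc.prems in \<open>auto simp: indep_vars_def\<close>)
    show "{\<omega> \<in> space M. norm (?Y (Suc (Suc k)) \<omega>) \<ge> R powr (l ^ Suc k)} \<in> events"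
      by measurable
  qed
  finally show ?case .
qed

section \<open>Explosion probabilities of Euler schemes\<close>

locale superlinear_coefficients =
  fixes f :: "real ^ 'd \<Rightarrow> real ^ 'd" and g :: "real ^ 'd \<Rightarrow> real ^ 'd ^ 'd"
    and \<gamma> l H :: real
  assumes f_measurable: "f \<in> borel_measurable borel"
    and g_measurable: "g \<in> borel_measurable borel"
    and exponents: "\<gamma> > l" "l > 1"
    and H_ge_1: "H \<ge> 1"
    and max_growth: "\<And>x. norm x \<ge> H \<Longrightarrow> max (norm (f x)) (op_norm (g x)) \<ge> 1 / H * norm x powr \<gamma>"
    and min_growth: "\<And>x. norm x \<ge> H \<Longrightarrow> min (norm (f x)) (op_norm (g x)) \<le> H * norm x powr l"
begin

text \<open>The factor \<open>2\<close> in front of \<open>e\<close> compensates the factor \<open>2\<close> in \<open>op_norm_functional\<close>.\<close>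

lemma explosive_step_prob_ge:
  assumes prob: "prob_space (pareto \<alpha> :: (real ^ 'd) measure)"
    and C: "C \<ge> 0" "\<And>(w :: real ^ 'd) e. w \<noteq> 0 \<Longrightarrow> e > 0 \<Longrightarrow>
       measure (pareto \<alpha>) {z. (1 < norm z \<and> norm z \<le> 2) \<and> e * norm w \<le> \<bar>w \<bullet> z\<bar>}
         \<ge> 1 - 2 powr (-\<alpha>) - C * e"
    and y: "norm y \<ge> H" and ab: "a \<ge> 0" "b \<ge> 0" and e: "e > 0"
    and noise: "b * e * norm y powr (\<gamma> - l) \<ge> H * (2 + a * H)"
    and drift: "a * norm y powr (\<gamma> - l) \<ge> H * (2 + 2 * b * H)"
  shows "measure (pareto \<alpha>) {z. norm (euler_step f g a b y z) \<ge> norm y powr l}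
           \<ge> 1 - 2 powr (-\<alpha>) - C * (2 * e)"
proof -
  interpret P: prob_space "pareto \<alpha> :: (real ^ 'd) measure" by fact
  obtain w where w: "op_norm (g y) \<le> 2 * norm w" "\<And>z. \<bar>w \<bullet> z\<bar> \<le> norm (g y *v z)"
    using op_norm_functional by blast
  define G where "G = {z. (1 < norm z \<and> norm z \<le> 2) \<and> 2 * e * norm w \<le> \<bar>w \<bullet> z\<bar>}"
  have "1 - 2 powr (-\<alpha>) - C * (2 * e) \<le> P.prob G"
  proof (cases "w = 0")
    case True
    then show ?thesis using C(1) e by (simp add: G_def measure_pareto_annulus[OF prob])
  next
    case False
    then show ?thesis using C(2)[OF False, of "2 * e"] e by (simp add: G_def)
  qed
  also have "\<dots> \<le> P.prob {z. norm (euler_step f g a b y z) \<ge> norm y powr l}"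
  proof (rule P.finite_measure_mono)
    show "G \<subseteq> {z. norm (euler_step f g a b y z) \<ge> norm y powr l}"
    proof safe
      fix z assume z: "z \<in> G"
      have "e * op_norm (g y) \<le> e * (2 * norm w)" using w e by (intro mult_left_mono) auto
      also have "\<dots> \<le> norm (g y *v z)" using z w(2)[of z] by (simp add: G_def)
      finally have "e * op_norm (g y) \<le> norm (g y *v z)" .
      then show "norm (euler_step f g a b y z) \<ge> norm y powr l"
        using y z e exponents H_ge_1
        by (intro euler_step_explodes[where f = f and g = g and \<gamma> = \<gamma> and e = e, OF _ _ H_ge_1 ab max_growth[OF y] min_growth[OF y] _ _ _ noise drift])
           (auto simp: G_def)
    qed
    show "{z. norm (euler_step f g a b y z) \<ge> norm y powr l} \<in> P.events"
      unfolding euler_step_def by measurable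
  qed
  finally show ?thesis .
qed

text \<open>The threshold \<open>R n\<close> has to be so large that one step at scale \<open>1 / n\<close> explodes in all directions
  up to a slab of width of order \<open>1 / n\<close>. Because \<open>\<gamma> > l\<close>, a polynomial in \<open>n\<close> suffices, and by the
  heavy tail the first step exceeds a polynomial with at least polynomially small probability.\<close>

lemma explosion_thresholds:
  assumes prob: "prob_space (pareto \<alpha> :: (real ^ 'd) measure)"
    and \<alpha>: "0 < \<alpha>" and T: "T > 0" and b0: "b0 > 0" and x0: "g x0 \<noteq> 0"
  obtains R :: "nat \<Rightarrow> real" and c m :: real where "c > 0" "\<And>n. n \<ge> 1 \<Longrightarrow> R n \<ge> 2"
    "\<And>n. n \<ge> 1 \<Longrightarrow> measure (pareto \<alpha>)
        {z. norm (euler_step f g (T / real n) (b0 * real n powr (- (1 / \<alpha>))) x0 z) \<ge> R n} \<ge> c * real n powr (- m)"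
    "\<And>n y. n \<ge> 1 \<Longrightarrow> norm y \<ge> R n \<Longrightarrow> measure (pareto \<alpha>)
        {z. norm (euler_step f g (T / real n) (b0 * real n powr (- (1 / \<alpha>))) y z) \<ge> norm y powr l}
          \<ge> (1 - 2 powr (-\<alpha>)) * (1 - 1 / (2 * real n))"
proof -
  interpret P: prob_space "pareto \<alpha> :: (real ^ 'd) measure" by fact
  define \<rho> where "\<rho> = 1 - 2 powr (-\<alpha>)"
  have \<rho>: "\<rho> > 0" using \<alpha> by (simp add: \<rho>_def powr_less_one)
  obtain C where C: "C \<ge> 1" "\<And>(w :: real ^ 'd) e. w \<noteq> 0 \<Longrightarrow> e > 0 \<Longrightarrow>
       measure (pareto \<alpha>) {z. (1 < norm z \<and> norm z \<le> 2) \<and> e * norm w \<le> \<bar>w \<bullet> z\<bar>} \<ge> \<rho> - C * e"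
    unfolding \<rho>_def by (rule measure_pareto_annulus_minus_slab_ge[OF prob \<alpha>]) blast
  obtain c where c: "c > 0" "\<And>(w :: real ^ 'd) L. w \<noteq> 0 \<Longrightarrow> L \<ge> 1 \<Longrightarrow>
       measure (pareto \<alpha>) {z. L * norm w \<le> \<bar>w \<bullet> z\<bar>} \<ge> c * L powr (-\<alpha>)"
    by (rule measure_pareto_far_ge[OF prob \<alpha>]) blast
  \<comment> \<open>For \<open>e = e0 / n\<close> the loss per step is the fraction \<open>1 / (2 * n)\<close> of \<open>\<rho>\<close>.\<close>
  define e0 where "e0 = \<rho> / (4 * C)"
  have e0: "e0 > 0" using \<rho> C by (simp add: e0_def)
  \<comment> \<open>Both growth conditions of \<open>euler_step_explodes\<close> follow once \<open>norm y powr (\<gamma> - l)\<close> is at least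
    \<open>Q * n powr (1 + 1 / \<alpha>)\<close>: the noise scale gives \<open>1 / \<alpha>\<close> and the slab width gives \<open>1\<close>.\<close>
  define Q where "Q = max (H * (2 + T * H) / (b0 * e0)) (H * (2 + 2 * b0 * H) / T)"
  have "H * (2 + 2 * b0 * H) / T > 0"
    using T b0 H_ge_1 by (intro divide_pos_pos mult_pos_pos add_pos_pos) auto
  then have Q: "Q > 0" by (simp add: Q_def less_max_iff_disj)
  define A where "A = max (max 2 H) (Q powr (1 / (\<gamma> - l)))"
  have A: "A \<ge> 2" "A \<ge> H" by (auto simp: A_def)
  have "Q = (Q powr (1 / (\<gamma> - l))) powr (\<gamma> - l)" using Q exponents by (simp add: powr_powr)
  also have "\<dots> \<le> A powr (\<gamma> - l)" using exponents by (intro powr_mono2) (auto simp: A_def)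
  finally have AQ: "Q \<le> A powr (\<gamma> - l)" .
  define m where "m = (1 + 1 / \<alpha>) / (\<gamma> - l)"
  have m: "m > 0" using \<alpha> exponents by (auto simp: m_def intro!: divide_pos_pos add_pos_pos)
  define R where "R n = A * real n powr m" for n
  have RA: "R n \<ge> A" if "n \<ge> 1" for n
    using that m A mult_left_mono[of 1 "real n powr m" A] by (simp add: R_def ge_one_powr_ge_zero)
  obtain w where w: "op_norm (g x0) \<le> 2 * norm w" "\<And>z. \<bar>w \<bullet> z\<bar> \<le> norm (g x0 *v z)"
    using op_norm_functional by blast
  have "op_norm (g x0) > 0" using op_norm_nonneg[of "g x0"] x0 by (simp add: op_norm_eq_0_iff less_le)
  then have w0: "norm w > 0" using w(1) by linarith
  \<comment> \<open>In the first step the noise must beat \<open>R n\<close>, the initial value and the drift together;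
    dividing by the noise scale raises the degree from \<open>m\<close> to \<open>m + 1 / \<alpha>\<close>.\<close>
  define D where "D = max 1 ((A + norm x0 + T * norm (f x0)) / (b0 * norm w))"
  show ?thesis
  proof (rule that[of "c * D powr (-\<alpha>)" R "(m + 1 / \<alpha>) * \<alpha>"])
    have "D \<ge> 1" by (simp add: D_def)
    then have "D > 0" by linarith
    then show "c * D powr (-\<alpha>) > 0" using c by simp
    fix n :: nat assume n: "n \<ge> 1"
    define N where "N = real n"
    have N: "N \<ge> 1" using n by (simp add: N_def)
    define b where "b = b0 * N powr (- (1 / \<alpha>))"
    have b: "b > 0" using b0 N by (simp add: b_def)
    have bb0: "b \<le> b0" using b0 N \<alpha> powr_mono[of "- (1 / \<alpha>)" 0 N] by (simp add: b_def)
    show "R n \<ge> 2" using RA[OF n] A by linarith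
    define L where "L = D * N powr (m + 1 / \<alpha>)"
    have L: "L \<ge> 1" using \<open>D \<ge> 1\<close> N m \<alpha> mult_mono[of 1 D 1 "N powr (m + 1 / \<alpha>)"]
      by (simp add: L_def ge_one_powr_ge_zero)
    have "c * D powr (-\<alpha>) * N powr (- ((m + 1 / \<alpha>) * \<alpha>)) = c * L powr (-\<alpha>)"
      using \<open>D > 0\<close> N by (simp add: L_def powr_mult powr_powr)
    also have "\<dots> \<le> P.prob {z. L * norm w \<le> \<bar>w \<bullet> z\<bar>}" using w0 L by (intro c) auto
    also have "\<dots> \<le> P.prob {z. norm (euler_step f g (T / N) b x0 z) \<ge> R n}"
    proof (rule P.finite_measure_mono)
      show "{z. norm (euler_step f g (T / N) b x0 z) \<ge> R n} \<in> P.events"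
        unfolding euler_step_def by measurable
      show "{z. L * norm w \<le> \<bar>w \<bullet> z\<bar>} \<subseteq> {z. norm (euler_step f g (T / N) b x0 z) \<ge> R n}"
      proof safe
        fix z assume z: "L * norm w \<le> \<bar>w \<bullet> z\<bar>"
        have Nm: "N powr m \<ge> 1" using N m by (simp add: ge_one_powr_ge_zero)
        have TN: "T / N * norm (f x0) \<le> T * norm (f x0) * N powr m"
        proof -
          have "T / N * norm (f x0) \<le> T * norm (f x0)"
            using T N by (intro mult_right_mono) (auto simp: divide_simps)
          also have "\<dots> \<le> T * norm (f x0) * N powr m"
            using Nm T mult_left_mono[OF Nm, of "T * norm (f x0)"] by simp
          finally show ?thesis .
        qed
        have xN: "norm x0 \<le> norm x0 * N powr m" using mult_left_mono[OF Nm, of "norm x0"] by simp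
        have "A + norm x0 + T * norm (f x0) \<le> b0 * norm w * D"
          using b0 w0 by (simp add: D_def max_def divide_simps mult_ac)
        then have "(A + norm x0 + T * norm (f x0)) * N powr m \<le> b0 * norm w * D * N powr m"
          by (intro mult_right_mono) auto
        also have "\<dots> = b * (L * norm w)" using N by (simp add: b_def L_def powr_add powr_minus field_simps)
        also have "\<dots> \<le> b * norm (g x0 *v z)" using z w(2)[of z] b by (intro mult_left_mono) auto
        finally have "R n + norm x0 + T / N * norm (f x0) \<le> norm (b *\<^sub>R (g x0 *v z))"
          using TN xN b by (simp add: R_def N_def[symmetric] distrib_right)
        moreover have "norm (b *\<^sub>R (g x0 *v z)) \<le> norm (euler_step f g (T / N) b x0 z) + norm (x0 + (T / N) *\<^sub>R f x0)"
          using norm_triangle_ineq4[of "euler_step f g (T / N) b x0 z" "x0 + (T / N) *\<^sub>R f x0"]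
          by (simp add: euler_step_def)
        moreover have "norm (x0 + (T / N) *\<^sub>R f x0) \<le> norm x0 + T / N * norm (f x0)"
          using norm_triangle_ineq[of x0 "(T / N) *\<^sub>R f x0"] T N by simp
        ultimately show "R n \<le> norm (euler_step f g (T / N) b x0 z)" by linarith
      qed
    qed
    finally show "measure (pareto \<alpha>)
        {z. norm (euler_step f g (T / real n) (b0 * real n powr (- (1 / \<alpha>))) x0 z) \<ge> R n}
          \<ge> c * D powr (-\<alpha>) * real n powr (- ((m + 1 / \<alpha>) * \<alpha>))"
      by (simp add: b_def N_def)
    fix y :: "real ^ 'd" assume y: "norm y \<ge> R n"
    have yA: "norm y \<ge> A" using y RA[OF n] by linarith
    have "Q * N powr (1 + 1 / \<alpha>) \<le> A powr (\<gamma> - l) * N powr (1 + 1 / \<alpha>)"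
      using AQ by (intro mult_right_mono) auto
    also have "\<dots> = R n powr (\<gamma> - l)"
      using A N exponents by (simp add: R_def N_def[symmetric] powr_mult powr_powr m_def)
    also have "\<dots> \<le> norm y powr (\<gamma> - l)"
      using y RA[OF n] A exponents by (intro powr_mono2) auto
    finally have Qy: "Q * N powr (1 + 1 / \<alpha>) \<le> norm y powr (\<gamma> - l)" .
    have "P.prob {z. norm (euler_step f g (T / N) b y z) \<ge> norm y powr l}
        \<ge> \<rho> - C * (2 * (e0 / N))"
      unfolding \<rho>_def
    proof (rule explosive_step_prob_ge[OF prob])
      have "H * (2 + T / N * H) \<le> H * (2 + T * H)"
        using H_ge_1 T N by (intro mult_left_mono add_left_mono mult_right_mono) (auto simp: divide_simps)
      also have "\<dots> \<le> b0 * e0 * Q"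
      proof -
        have "H * (2 + T * H) / (b0 * e0) \<le> Q" by (simp add: Q_def)
        then show ?thesis using b0 e0 by (simp add: pos_divide_le_eq mult_ac)
      qed
      also have "\<dots> = b * (e0 / N) * (Q * N powr (1 + 1 / \<alpha>))"
        using N by (simp add: b_def powr_add powr_minus field_simps)
      also have "\<dots> \<le> b * (e0 / N) * norm y powr (\<gamma> - l)"
        using Qy b e0 N by (intro mult_left_mono) auto
      finally show "H * (2 + T / N * H) \<le> b * (e0 / N) * norm y powr (\<gamma> - l)" .
      have "H * (2 + 2 * b * H) \<le> H * (2 + 2 * b0 * H)"
        using H_ge_1 bb0 by (intro mult_left_mono add_left_mono mult_right_mono) auto
      also have "\<dots> \<le> T * Q"
      proof -
        have "H * (2 + 2 * b0 * H) / T \<le> Q" by (simp add: Q_def)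
        then show ?thesis using T by (simp add: pos_divide_le_eq mult_ac)
      qed
      also have "\<dots> \<le> T * Q * N powr (1 / \<alpha>)"
        using T Q N \<alpha> mult_left_mono[of 1 "N powr (1 / \<alpha>)" "T * Q"] by (simp add: ge_one_powr_ge_zero)
      also have "\<dots> = T / N * (Q * N powr (1 + 1 / \<alpha>))"
        using N by (simp add: powr_add)
      also have "\<dots> \<le> T / N * norm y powr (\<gamma> - l)"
        using Qy T N by (intro mult_left_mono) auto
      finally show "H * (2 + 2 * b * H) \<le> T / N * norm y powr (\<gamma> - l)" .
    qed (use C yA A T N b e0 in \<open>auto simp: \<rho>_def\<close>)
    also have "\<rho> - C * (2 * (e0 / N)) = \<rho> * (1 - 1 / (2 * N))"
      using C N by (simp add: e0_def field_simps)
    finally show "measure (pareto \<alpha>)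
        {z. norm (euler_step f g (T / real n) (b0 * real n powr (- (1 / \<alpha>))) y z) \<ge> norm y powr l}
          \<ge> (1 - 2 powr (-\<alpha>)) * (1 - 1 / (2 * real n))"
      by (simp add: b_def N_def \<rho>_def)
  qed
qed

text \<open>Besides independence, all that is asked of the noise is that its law dominates a multiple \<open>\<theta>\<close> of the
  Pareto law, so that both schemes are covered. The factors \<open>1 - 1 / (2 * n)\<close> of the \<open>n - 1\<close> steps after the first have
  a product of at least \<open>1 / 2\<close>.\<close>

lemma euler_explosion_prob:
  fixes M :: "'w measure"
  assumes pareto: "prob_space (pareto \<alpha> :: (real ^ 'd) measure)"
    and \<alpha>: "0 < \<alpha>" and T: "T > 0" and b0: "b0 > 0" and x0: "g x0 \<noteq> 0" and \<theta>: "\<theta> > 0"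
    and M: "prob_space M"
  obtains A m :: real where "A > 0"
    "\<And>n \<xi>. n \<ge> 1 \<Longrightarrow> prob_space.indep_vars M (\<lambda>_. borel) \<xi> {..<n} \<Longrightarrow>
      (\<And>k B. k < n \<Longrightarrow> B \<in> sets borel \<Longrightarrow>
         measure M (\<xi> k -` B \<inter> space M) \<ge> \<theta> * measure (pareto \<alpha> :: (real ^ 'd) measure) B) \<Longrightarrow>
      {\<omega> \<in> space M. norm (noise_chain
          (euler_step f g (T / real n) (b0 * real n powr (- (1 / \<alpha>)))) x0 (\<lambda>i. \<xi> i \<omega>) n) \<ge> 2 powr (l ^ (n - 1))} \<in> sets M \<and>
      measure M {\<omega> \<in> space M. norm (noise_chain
          (euler_step f g (T / real n) (b0 * real n powr (- (1 / \<alpha>)))) x0 (\<lambda>i. \<xi> i \<omega>) n) \<ge> 2 powr (l ^ (n - 1))}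
        \<ge> A * real n powr (- m) * (\<theta> * (1 - 2 powr (-\<alpha>))) ^ n"
proof -
  interpret prob_space M by fact
  define \<rho> where "\<rho> = 1 - 2 powr (-\<alpha>)"
  have \<rho>: "\<rho> > 0" "\<rho> \<le> 1" using \<alpha> by (simp_all add: \<rho>_def powr_less_one)
  obtain R c m where c: "c > 0" and R: "\<And>n. n \<ge> 1 \<Longrightarrow> R n \<ge> 2"
    and start: "\<And>n. n \<ge> 1 \<Longrightarrow> measure (pareto \<alpha>)
        {z. norm (euler_step f g (T / real n) (b0 * real n powr (- (1 / \<alpha>))) x0 z) \<ge> R n} \<ge> c * real n powr (- m)"
    and step: "\<And>n y. n \<ge> 1 \<Longrightarrow> norm y \<ge> R n \<Longrightarrow> measure (pareto \<alpha>)
        {z. norm (euler_step f g (T / real n) (b0 * real n powr (- (1 / \<alpha>))) y z) \<ge> norm y powr l}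
          \<ge> \<rho> * (1 - 1 / (2 * real n))"
    unfolding \<rho>_def by (rule explosion_thresholds[OF pareto \<alpha> T b0 x0]) blast
  show ?thesis
  proof (rule that[of "c / 2" m])
    show "c / 2 > 0" using c by simp
    fix n :: nat and \<xi> :: "nat \<Rightarrow> 'w \<Rightarrow> real ^ 'd"
    assume n: "n \<ge> 1" and ind: "indep_vars (\<lambda>_. borel) \<xi> {..<n}"
      and dom: "\<And>k B. k < n \<Longrightarrow> B \<in> sets borel \<Longrightarrow>
         prob (\<xi> k -` B \<inter> space M) \<ge> \<theta> * measure (pareto \<alpha> :: (real ^ 'd) measure) B"
    define F where "F = euler_step f g (T / real n) (b0 * real n powr (- (1 / \<alpha>)))"
    have Fm: "(\<lambda>(y, z). F y z) \<in> borel_measurable (borel \<Otimes>\<^sub>M borel)"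
      unfolding F_def by (rule euler_step_measurable[OF f_measurable g_measurable])
    have Fs: "{z. norm (F y z) \<ge> r} \<in> sets borel" for y r
      unfolding F_def euler_step_def by measurable
    let ?Y = "\<lambda>\<omega>. noise_chain F x0 (\<lambda>i. \<xi> i \<omega>) n"
    have [measurable]: "?Y \<in> borel_measurable M"
      by (rule noise_chain_measurable[OF Fm]) (use ind in \<open>auto simp: indep_vars_def\<close>)
    have event: "{\<omega> \<in> space M. norm (?Y \<omega>) \<ge> 2 powr (l ^ (n - 1))} \<in> events" by measurable
    have bern: "(1 - 1 / (2 * real n)) ^ (n - 1) \<ge> 1 / 2"
    proof -
      have "1 / 2 \<le> 1 + real (n - 1) * (- 1 / (2 * real n))" using n by (simp add: field_simps of_nat_diff)
      also have "\<dots> \<le> (1 + (- 1 / (2 * real n))) ^ (n - 1)"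
        using n by (intro Bernoulli_inequality) (simp add: field_simps)
      finally show ?thesis by simp
    qed
    have "c / 2 * real n powr (- m) * (\<theta> * \<rho>) ^ n = c * real n powr (- m) * \<theta> * \<rho> * ((\<theta> * \<rho>) ^ (n - 1) * (1 / 2))"
      using n by (subst power_minus_mult[symmetric]) (auto simp: field_simps)
    also have "\<dots> \<le> c * real n powr (- m) * \<theta> * 1 * ((\<theta> * \<rho>) ^ (n - 1) * (1 - 1 / (2 * real n)) ^ (n - 1))"
      using bern \<rho> \<theta> c by (intro mult_mono mult_left_mono) auto
    also have "\<dots> = (\<theta> * (c * real n powr (- m))) * (\<theta> * (\<rho> * (1 - 1 / (2 * real n)))) ^ (n - 1)"
      by (simp add: power_mult_distrib)
    also have "\<dots> \<le> prob {\<omega> \<in> space M. norm (noise_chain F x0 (\<lambda>i. \<xi> i \<omega>) (Suc (n - 1))) \<ge> R n powr (l ^ (n - 1))}"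
    proof (rule noise_chain_prob_ge[OF ind Fm])
      show "R n \<ge> 1" "l \<ge> 1" "n - 1 < n" using R[OF n] exponents n by auto
      show "\<theta> * (\<rho> * (1 - 1 / (2 * real n))) \<ge> 0" using \<theta> \<rho> n by simp
      have "\<theta> * (c * real n powr (- m)) \<le> \<theta> * measure (pareto \<alpha>) {z. norm (F x0 z) \<ge> R n}"
        unfolding F_def using start[OF n] \<theta> by (intro mult_left_mono) auto
      also have "\<dots> \<le> prob (\<xi> 0 -` {z. norm (F x0 z) \<ge> R n} \<inter> space M)" using n by (intro dom Fs) auto
      finally show "prob (\<xi> 0 -` {z. norm (F x0 z) \<ge> R n} \<inter> space M) \<ge> \<theta> * (c * real n powr (- m))" .
      fix k and y :: "real ^ 'd" assume k: "k < n" and y: "norm y \<ge> R n"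
      have "\<theta> * (\<rho> * (1 - 1 / (2 * real n))) \<le> \<theta> * measure (pareto \<alpha>) {z. norm (F y z) \<ge> norm y powr l}"
        unfolding F_def using step[OF n y] \<theta> by (intro mult_left_mono) auto
      also have "\<dots> \<le> prob (\<xi> k -` {z. norm (F y z) \<ge> norm y powr l} \<inter> space M)" using k by (intro dom Fs) auto
      finally show "prob (\<xi> k -` {z. norm (F y z) \<ge> norm y powr l} \<inter> space M) \<ge> \<theta> * (\<rho> * (1 - 1 / (2 * real n)))" .
    qed
    also have "\<dots> \<le> prob {\<omega> \<in> space M. norm (?Y \<omega>) \<ge> 2 powr (l ^ (n - 1))}"
    proof (rule finite_measure_mono)
      have "2 powr (l ^ (n - 1)) \<le> R n powr (l ^ (n - 1))"
        using R[OF n] exponents by (intro powr_mono2) auto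
      then show "{\<omega> \<in> space M. norm (noise_chain F x0 (\<lambda>i. \<xi> i \<omega>) (Suc (n - 1))) \<ge> R n powr (l ^ (n - 1))}
          \<subseteq> {\<omega> \<in> space M. norm (?Y \<omega>) \<ge> 2 powr (l ^ (n - 1))}"
        using n by (auto simp del: noise_chain.simps)
    qed (rule event)
    finally show "{\<omega> \<in> space M. norm (noise_chain
          (euler_step f g (T / real n) (b0 * real n powr (- (1 / \<alpha>)))) x0 (\<lambda>i. \<xi> i \<omega>) n) \<ge> 2 powr (l ^ (n - 1))} \<in> events \<and>
      prob {\<omega> \<in> space M. norm (noise_chain
          (euler_step f g (T / real n) (b0 * real n powr (- (1 / \<alpha>)))) x0 (\<lambda>i. \<xi> i \<omega>) n) \<ge> 2 powr (l ^ (n - 1))}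
        \<ge> c / 2 * real n powr (- m) * (\<theta> * (1 - 2 powr (-\<alpha>))) ^ n"
      using event unfolding F_def \<rho>_def by blast
  qed
qed

end

section \<open>Both schemes as noise-driven chains\<close>

lemma stable_euler_eq_noise_chain:
  assumes "b > 0"
  shows "stable_euler f g Z x0 \<eta> k \<omega>
    = noise_chain (euler_step f g \<eta> b) x0
        (\<lambda>i. inverse b *\<^sub>R (Z (real (Suc i) * \<eta>) \<omega> - Z (real i * \<eta>) \<omega>)) k"
  using assms by (induction k) (simp_all add: euler_step_def Let_def matrix_vector_mult_scaleR)

lemma pareto_euler_eq_noise_chain:
  fixes x0 :: "real ^ 'd"
  shows "pareto_euler \<alpha> f g X x0 \<eta> k \<omega>
    = noise_chain (euler_step f g \<eta> (1 / pareto_scale CARD('d) \<alpha> * \<eta> powr (1 / \<alpha>))) x0 (\<lambda>i. X (Suc i) \<omega>) k"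
  by (induction k) (simp_all add: euler_step_def Let_def)

lemma (in prob_space) indep_vars_reindex_inj:
  assumes ind: "indep_vars (\<lambda>_. N) X I" and h: "inj_on h J" "h ` J \<subseteq> I"
  shows "indep_vars (\<lambda>_. N) (\<lambda>j. X (h j)) J"
proof (cases "J = {}")
  case True
  then show ?thesis by (simp add: indep_vars_def indep_sets_def)
next
  case False
  show ?thesis
    unfolding indep_vars_def2
  proof (intro conjI ballI indep_setsI)
    fix j assume "j \<in> J"
    then have hj: "h j \<in> I" using h by auto
    then show rv: "random_variable N (X (h j))" using ind by (auto simp: indep_vars_def2)
    then show "{X (h j) -` A \<inter> space M |A. A \<in> sets N} \<subseteq> events" by auto
  next
    fix A K assume K: "K \<noteq> {}" "K \<subseteq> J" "finite K"
      and A: "\<forall>j\<in>K. A j \<in> {X (h j) -` A \<inter> space M |A. A \<in> sets N}"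
    define A' where "A' i = A (the_inv_into K h i)" for i
    have inj: "inj_on h K" using h K inj_on_subset by blast
    have A': "A' (h j) = A j" if "j \<in> K" for j
      using that inj by (simp add: A'_def the_inv_into_f_f)
    have "prob (\<Inter>i\<in>h ` K. A' i) = (\<Prod>i\<in>h ` K. prob (A' i))"
    proof (rule indep_setsD)
      show "indep_sets (\<lambda>i. {X i -` A \<inter> space M |A. A \<in> sets N}) I"
        using ind by (simp add: indep_vars_def2)
      show "\<forall>i\<in>h ` K. A' i \<in> {X i -` A \<inter> space M |A. A \<in> sets N}"
        using A A' by auto
    qed (use K h in auto)
    then show "prob (\<Inter>j\<in>K. A j) = (\<Prod>j\<in>K. prob (A j))"
      using A' by (simp add: prod.reindex[OF inj] cong: INF_cong prod.cong)
  qed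
qed

section \<open>Stable increments dominate Pareto noise\<close>

lemma kappa_inverse: "1 - 2 powr (-\<alpha>) = inverse (kappa \<alpha>)"
  by (simp add: kappa_def powr_minus divide_simps)

lemma kappa_pos: "0 < \<alpha> \<Longrightarrow> kappa \<alpha> > 0"
  by (simp add: kappa_def)

text \<open>The multiple of the Pareto law that lies below the law of a normalised stable increment; it is the
  ratio \<open>kappa / delta\<close> of the two rates.\<close>

definition stable_weight :: "nat \<Rightarrow> real \<Rightarrow> real \<Rightarrow> real" where
  "stable_weight d \<alpha> K = sphere_area d / (2 powr (real d + \<alpha>) * \<alpha> * K)"

lemma stable_weight_pos: "0 < \<alpha> \<Longrightarrow> K \<ge> 1 \<Longrightarrow> d \<ge> 1 \<Longrightarrow> stable_weight d \<alpha> K > 0"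
  unfolding stable_weight_def using sphere_area_pos[of d] by (intro divide_pos_pos mult_pos_pos) auto

lemma delta_inverse:
  "stable_weight d \<alpha> K * (1 - 2 powr (-\<alpha>)) = inverse (delta d \<alpha> K)"
  by (simp add: stable_weight_def delta_def field_simps)

lemma delta_pos: "0 < \<alpha> \<Longrightarrow> K \<ge> 1 \<Longrightarrow> d \<ge> 1 \<Longrightarrow> delta d \<alpha> K > 0"
  unfolding delta_def using sphere_area_pos[of d]
  by (intro mult_pos_pos divide_pos_pos) (auto simp: powr_less_one)

text \<open>After rescaling to time \<open>1\<close>, the lower density bound reads \<open>inverse K * (1 + \<bar>z\<bar>) powr (- d - \<alpha>)\<close>. Where
  \<open>\<bar>z\<bar> > 1\<close> one may replace \<open>1 + \<bar>z\<bar>\<close> by \<open>2 * \<bar>z\<bar>\<close>, and the Pareto density appears.\<close>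

lemma emeasure_scaled_stable_ge:
  fixes Z :: "'w \<Rightarrow> real ^ 'd" and p :: "real ^ 'd \<Rightarrow> real"
  assumes dist: "distributed M lborel Z (\<lambda>x. ennreal (p x))" and \<alpha>: "0 < \<alpha>" and K: "K \<ge> 1" and t: "t > 0"
    and bound: "\<And>x. inverse K * (t / (t powr (1 / \<alpha>) + norm x) powr (real CARD('d) + \<alpha>)) \<le> p x"
    and B: "B \<in> sets borel"
  shows "emeasure (distr M borel (\<lambda>\<omega>. inverse (t powr (1 / \<alpha>)) *\<^sub>R Z \<omega>)) B
    \<ge> ennreal (stable_weight CARD('d) \<alpha> K) * emeasure (pareto \<alpha>) B"
proof -
  define s where "s = t powr (1 / \<alpha>)"
  have s: "s > 0" using t by (simp add: s_def)
  have t_eq: "t = s powr \<alpha>" using t \<alpha> by (simp add: s_def powr_powr)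
  have Zm [measurable]: "Z \<in> borel_measurable M" using distributed_measurable[OF dist] by simp
  have pm [measurable]: "(\<lambda>x. ennreal (p x)) \<in> borel_measurable borel"
    using distributed_borel_measurable[OF dist] by simp
  note B [measurable]
  have dens: "stable_weight CARD('d) \<alpha> K * pareto_density \<alpha> z \<le> s ^ CARD('d) * p (s *\<^sub>R z)" for z
  proof (cases "norm z > 1")
    case True
    define N where "N = norm z powr (real CARD('d) + \<alpha>)"
    have "z \<noteq> 0" using True by auto
    then have N: "N > 0" by (simp add: N_def)
    have sp: "sphere_area CARD('d) > 0" by (rule sphere_area_pos) simp
    have "stable_weight CARD('d) \<alpha> K * pareto_density \<alpha> z = inverse K / (2 powr (real CARD('d) + \<alpha>) * N)"
      using True sp \<alpha> by (simp add: stable_weight_def pareto_density_def N_def add.commute divide_simps)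
    also have "\<dots> = inverse K / (2 * norm z) powr (real CARD('d) + \<alpha>)"
      by (simp add: N_def powr_mult)
    also have "\<dots> \<le> inverse K / (1 + norm z) powr (real CARD('d) + \<alpha>)"
      using True K \<alpha> by (intro divide_left_mono powr_mono2 mult_pos_pos) force+
    also have "\<dots> = s ^ CARD('d) * (inverse K * (t / (s + norm (s *\<^sub>R z)) powr (real CARD('d) + \<alpha>)))"
    proof -
      have "s + norm (s *\<^sub>R z) = s * (1 + norm z)" using s by (simp add: algebra_simps)
      then have "(s + norm (s *\<^sub>R z)) powr (real CARD('d) + \<alpha>)
          = s ^ CARD('d) * t * (1 + norm z) powr (real CARD('d) + \<alpha>)"
        using s by (simp only: powr_mult) (simp add: powr_add powr_realpow t_eq)
      then show ?thesis using s t by simp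
    qed
    also have "\<dots> \<le> s ^ CARD('d) * p (s *\<^sub>R z)"
      using bound[of "s *\<^sub>R z"] s by (intro mult_left_mono) (auto simp: s_def)
    finally show ?thesis .
  next
    case False
    have "0 \<le> inverse K * (t / (t powr (1 / \<alpha>) + norm (s *\<^sub>R z)) powr (real CARD('d) + \<alpha>))"
      using t K by simp
    also have "\<dots> \<le> p (s *\<^sub>R z)" by (rule bound)
    finally show ?thesis using False s by (simp add: pareto_density_eq_0)
  qed
  have w0: "stable_weight CARD('d) \<alpha> K > 0" by (rule stable_weight_pos[OF \<alpha> K]) simp
  have [measurable]: "(\<lambda>z::real^'d. inverse s *\<^sub>R z) -` B \<in> sets borel"
    by (rule measurable_sets_borel[OF _ B]) auto
  have "ennreal (stable_weight CARD('d) \<alpha> K) * emeasure (pareto \<alpha>) B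
      = (\<integral>\<^sup>+z. ennreal (stable_weight CARD('d) \<alpha> K * pareto_density \<alpha> z) * indicator B z \<partial>lborel)"
    using w0 by (subst emeasure_pareto)
      (auto simp: nn_integral_cmult[symmetric] ennreal_mult' mult.assoc B)
  also have "\<dots> \<le> (\<integral>\<^sup>+z. ennreal (s ^ CARD('d)) * (ennreal (p (s *\<^sub>R z)) * indicator B z) \<partial>lborel)"
    using dens s by (intro nn_integral_mono)
      (auto intro!: ennreal_leI simp flip: ennreal_mult' split: split_indicator)
  also have "\<dots> = ennreal (s ^ CARD('d)) * (\<integral>\<^sup>+z. ennreal (p (s *\<^sub>R z)) * indicator B (inverse s *\<^sub>R (s *\<^sub>R z)) \<partial>lborel)"
    using s by (subst nn_integral_cmult) auto
  also have "\<dots> = (\<integral>\<^sup>+x. ennreal (p x) * indicator B (inverse s *\<^sub>R x) \<partial>lborel)"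
    using s by (subst nn_integral_lborel_scale[where c = s]) auto
  also have "\<dots> = (\<integral>\<^sup>+x. ennreal (p x) * indicator ((\<lambda>z. inverse s *\<^sub>R z) -` B) x \<partial>lborel)"
    by (intro nn_integral_cong) (auto split: split_indicator)
  also have "\<dots> = emeasure M (Z -` ((\<lambda>z. inverse s *\<^sub>R z) -` B) \<inter> space M)"
    by (subst distributed_emeasure[OF dist]) auto
  also have "\<dots> = emeasure (distr M borel (\<lambda>\<omega>. inverse (t powr (1 / \<alpha>)) *\<^sub>R Z \<omega>)) B"
    by (subst emeasure_distr) (auto simp: s_def vimage_def)
  finally show ?thesis .
qed

section \<open>Asymptotics and moments\<close>

text \<open>Up to the constant \<open>A\<close>, the quotient \<open>c * n powr (m - c)\<close> of the two sides decreases in \<open>n\<close>,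
  so \<open>n = 2\<close> is the worst case, and there \<open>2 powr (- c)\<close> eventually beats the prefactor \<open>c\<close>. For \<open>n = 1\<close> the left side would be \<open>c\<close> itself.\<close>

lemma eventually_const_powr_le:
  fixes A m :: real
  assumes "A > 0"
  shows "\<forall>\<^sub>F c in at_top. \<forall>n\<ge>2. c * real n powr (- c) \<le> A * real n powr (- m)"
proof -
  have "((\<lambda>c::real. c * 2 powr (m - c)) \<longlongrightarrow> 0) at_top" by real_asymp
  then have "\<forall>\<^sub>F c in at_top. c * 2 powr (m - c) < A" using assms by (rule order_tendstoD)
  moreover have "\<forall>\<^sub>F c in at_top. c \<ge> max 0 m" by (rule eventually_ge_at_top)
  ultimately show ?thesis
  proof eventually_elim
    case (elim c)
    show ?case
    proof (intro allI impI)
      fix n :: nat assume n: "n \<ge> 2"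
      have "c * real n powr (- c) = c * real n powr (m - c) * real n powr (- m)"
        using n by (simp flip: powr_add)
      also have "\<dots> \<le> c * 2 powr (m - c) * real n powr (- m)"
        using n elim powr_mono2'[of "c - m" 2 "real n"]
        by (intro mult_right_mono mult_left_mono powr_mono2') auto
      also have "\<dots> \<le> A * real n powr (- m)" using elim by (intro mult_right_mono) auto
      finally show "c * real n powr (- c) \<le> A * real n powr (- m)" .
    qed
  qed
qed

lemma double_exponential_dominates:
  fixes A m D \<beta> l :: real
  assumes "A > 0" "D > 0" "\<beta> > 0" "l > 1"
  shows "filterlim (\<lambda>n. A * real n powr (- m) * D powr (- real n) * (2 powr (l ^ (n - 1))) powr \<beta>) at_top sequentially"
proof -
  have "filterlim (\<lambda>x::real. A * exp (b * exp (L * (x - 1)) - m * ln x - x * r)) at_top at_top"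
    if "b > 0" "L > 0" for b L r
    using that assms(1) by real_asymp
  then have "filterlim (\<lambda>x::real. A * exp (\<beta> * ln 2 * exp (ln l * (x - 1)) - m * ln x - x * ln D)) at_top at_top"
    using assms by simp
  then have "filterlim (\<lambda>n. A * exp (\<beta> * ln 2 * exp (ln l * (real n - 1)) - m * ln (real n) - real n * ln D)) at_top sequentially"
    by (rule filterlim_compose) (rule filterlim_real_sequentially)
  moreover have "\<forall>\<^sub>F n in sequentially. A * exp (\<beta> * ln 2 * exp (ln l * (real n - 1)) - m * ln (real n) - real n * ln D)
      = A * real n powr (- m) * D powr (- real n) * (2 powr (l ^ (n - 1))) powr \<beta>"
    using eventually_ge_at_top[of 1]
  proof eventually_elim
    case (elim n)
    have "exp (ln l * (real n - 1)) = l powr real (n - 1)"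
      using elim assms by (simp add: of_nat_diff powr_def mult.commute)
    also have "\<dots> = l ^ (n - 1)" using assms by (simp add: powr_realpow)
    finally have "exp (ln l * (real n - 1)) = l ^ (n - 1)" .
    moreover have "(2 powr (l ^ (n - 1))) powr \<beta> = exp (\<beta> * ln 2 * l ^ (n - 1))"
      by (simp add: powr_powr) (simp add: powr_def mult_ac)
    moreover have "real n powr (- m) = exp (- (m * ln (real n)))" "D powr (- real n) = exp (- (real n * ln D))"
      using elim assms by (simp_all add: powr_def)
    ultimately show ?case by (simp add: exp_diff exp_minus divide_inverse)
  qed
  ultimately show ?thesis by (simp only: filterlim_cong[OF refl refl])
qed

text \<open>Already the contribution of the rare event diverges: its probability decays exponentially, while
  the norm grows doubly exponentially on it.\<close>

lemma moments_diverge: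
  assumes ev: "\<And>n. n \<ge> 1 \<Longrightarrow> {\<omega> \<in> space M. norm (Y n \<omega>) \<ge> 2 powr (l ^ (n - 1))} \<in> sets M"
    and pr: "\<And>n. n \<ge> 1 \<Longrightarrow> emeasure M {\<omega> \<in> space M. norm (Y n \<omega>) \<ge> 2 powr (l ^ (n - 1))}
        \<ge> ennreal (A * real n powr (- m) * D powr (- real n))"
    and pos: "A > 0" "D > 0" "\<beta> > 0" "l > 1"
  shows "(\<lambda>n. \<integral>\<^sup>+\<omega>. ennreal (norm (Y n \<omega>) powr \<beta>) \<partial>M) \<longlonglongrightarrow> \<infinity>"
proof (rule tendsto_sandwich)
  show "(\<lambda>n. ennreal (A * real n powr (- m) * D powr (- real n) * (2 powr (l ^ (n - 1))) powr \<beta>)) \<longlonglongrightarrow> \<infinity>"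
    using double_exponential_dominates[OF pos] by (simp add: ennreal_tendsto_top_eq_at_top)
  show "\<forall>\<^sub>F n in sequentially. ennreal (A * real n powr (- m) * D powr (- real n) * (2 powr (l ^ (n - 1))) powr \<beta>)
      \<le> (\<integral>\<^sup>+\<omega>. ennreal (norm (Y n \<omega>) powr \<beta>) \<partial>M)"
    using eventually_ge_at_top[of 1]
  proof eventually_elim
    case (elim n)
    define E where "E = {\<omega> \<in> space M. norm (Y n \<omega>) \<ge> 2 powr (l ^ (n - 1))}"
    have E: "E \<in> sets M" unfolding E_def by (rule ev[OF elim])
    have "ennreal (A * real n powr (- m) * D powr (- real n) * (2 powr (l ^ (n - 1))) powr \<beta>)
        = ennreal ((2 powr (l ^ (n - 1))) powr \<beta>) * ennreal (A * real n powr (- m) * D powr (- real n))"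
      by (subst ennreal_mult'[symmetric]) (simp_all only: powr_ge_zero mult_ac)
    also have "\<dots> \<le> ennreal ((2 powr (l ^ (n - 1))) powr \<beta>) * emeasure M E"
      unfolding E_def using pr[OF elim] by (intro mult_left_mono) auto
    also have "\<dots> = (\<integral>\<^sup>+\<omega>. ennreal ((2 powr (l ^ (n - 1))) powr \<beta>) * indicator E \<omega> \<partial>M)"
      using E by (simp add: nn_integral_cmult_indicator)
    also have "\<dots> \<le> (\<integral>\<^sup>+\<omega>. ennreal (norm (Y n \<omega>) powr \<beta>) \<partial>M)"
      using pos by (intro nn_integral_mono) (auto simp: E_def intro!: ennreal_leI powr_mono2 split: split_indicator)
    finally show ?case .
  qed
qed auto

section \<open>Explosion and moment divergence of both schemes\<close>

theorem theorem1p3: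
  fixes M :: "'w measure"
    and \<alpha> K \<gamma> l H T :: real
    and x0 :: "real ^ 'd"
    and f :: "real ^ 'd \<Rightarrow> real ^ 'd"
    and g :: "real ^ 'd \<Rightarrow> real ^ 'd ^ 'd"
    and Z :: "real \<Rightarrow> 'w \<Rightarrow> real ^ 'd"
    and Zt :: "nat \<Rightarrow> 'w \<Rightarrow> real ^ 'd"
    and p :: "real \<Rightarrow> real ^ 'd \<Rightarrow> real"
    and Y Yt :: "nat \<Rightarrow> 'w \<Rightarrow> real ^ 'd"
  defines "Y \<equiv> \<lambda>n. stable_euler f g Z x0 (T / real n) n"
    and "Yt \<equiv> \<lambda>n. pareto_euler \<alpha> f g Zt x0 (T / real n) n"
  assumes "prob_space M"
    and "0 < \<alpha>" and "\<alpha> < 2"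
    and "f \<in> borel_measurable borel"
    and "g \<in> borel_measurable borel"
    and "\<gamma> > l" and "l > 1" and "H \<ge> 1"
    and "\<And>x. norm x \<ge> H \<Longrightarrow> max (norm (f x)) (op_norm (g x)) \<ge> 1 / H * norm x powr \<gamma>"
    and "\<And>x. norm x \<ge> H \<Longrightarrow> min (norm (f x)) (op_norm (g x)) \<le> H * norm x powr l"
    and "g x0 \<noteq> 0"
    and "T > 0"
    and "standard_stable_process M \<alpha> Z"
    and "transition_density M Z p"
    and "K \<ge> 1" and "stable_density_bounds \<alpha> K p"
    and "iid_pareto M \<alpha> Zt"
  shows "(\<exists>c>1.
      (\<exists>\<Omega> :: nat \<Rightarrow> 'w set.
         (\<forall>n\<ge>1. \<Omega> n \<in> sets M \<and> \<Omega> n \<noteq> {} \<and> measure M (\<Omega> n) > 0 \<and>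
            (\<forall>\<omega>\<in>\<Omega> n. norm (Y n \<omega>) \<ge> 2 powr (l ^ (n - 1)))) \<and>
         (\<forall>n\<ge>2. measure M (\<Omega> n) \<ge>
            c * real n powr (- c) * delta CARD('d) \<alpha> K powr (- real n))) \<and>
      (\<exists>\<Omega>t :: nat \<Rightarrow> 'w set.
         (\<forall>n\<ge>1. \<Omega>t n \<in> sets M \<and> \<Omega>t n \<noteq> {} \<and> measure M (\<Omega>t n) > 0 \<and>
            (\<forall>\<omega>\<in>\<Omega>t n. norm (Yt n \<omega>) \<ge> 2 powr (l ^ (n - 1)))) \<and>
         (\<forall>n\<ge>2. measure M (\<Omega>t n) \<ge>
            c * real n powr (- c) * kappa \<alpha> powr (- real n)))) \<and>
    (\<forall>\<beta>. 0 < \<beta> \<and> \<beta> < \<alpha> \<longrightarrow>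
      (\<lambda>n. \<integral>\<^sup>+\<omega>. ennreal (norm (Y n \<omega>) powr \<beta>) \<partial>M) \<longlonglongrightarrow> \<infinity> \<and>
      (\<lambda>n. \<integral>\<^sup>+\<omega>. ennreal (norm (Yt n \<omega>) powr \<beta>) \<partial>M) \<longlonglongrightarrow> \<infinity>)"
proof -
  interpret prob_space M by fact
  interpret superlinear_coefficients f g \<gamma> l H
    using assms(6-12) by unfold_locales auto
  note \<alpha> = \<open>0 < \<alpha>\<close> and T = \<open>T > 0\<close> and x0 = \<open>g x0 \<noteq> 0\<close> and l = \<open>l > 1\<close>
  have Xind: "indep_vars (\<lambda>_. borel) Zt {1..}"
    and Xdist: "\<And>k. k \<ge> 1 \<Longrightarrow> distributed M lborel (Zt k) (\<lambda>z. ennreal (pareto_density \<alpha> z))"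
    using \<open>iid_pareto M \<alpha> Zt\<close> by (auto simp: iid_pareto_def)
  have Xlaw: "distr M lborel (Zt k) = pareto \<alpha>" if "k \<ge> 1" for k
    unfolding pareto_def by (rule distributed_distr_eq_density[OF Xdist[OF that]])
  \<comment> \<open>The Pareto density integrates to \<open>1\<close> because it is the density of a random vector.\<close>
  have pareto: "prob_space (pareto \<alpha> :: (real ^ 'd) measure)"
    unfolding Xlaw[of 1, OF order_refl, symmetric]
    by (rule prob_space_distr) (use distributed_measurable[OF Xdist[of 1]] in simp)
  define E where "E V n = {\<omega> \<in> space M. norm (V n \<omega>) \<ge> 2 powr (l ^ (n - 1))}"
    for V :: "nat \<Rightarrow> 'w \<Rightarrow> real ^ 'd" and n
  have scale: "(T / real n) powr (1 / \<alpha>) = T powr (1 / \<alpha>) * real n powr (- (1 / \<alpha>))" for n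
    using T by (simp add: powr_divide powr_minus_divide)
  define \<sigma> where "\<sigma> = pareto_scale CARD('d) \<alpha>"
  have \<sigma>: "\<sigma> > 0" unfolding \<sigma>_def using \<alpha> \<open>\<alpha> < 2\<close> by (intro pareto_scale_char) auto

  obtain A2 m2 where A2: "A2 > 0"
    and key2: "\<And>n. n \<ge> 1 \<Longrightarrow> E Yt n \<in> sets M \<and> prob (E Yt n) \<ge> A2 * real n powr (- m2) * kappa \<alpha> powr (- real n)"
  proof -
    have b0: "T powr (1 / \<alpha>) / \<sigma> > 0" using T \<sigma> by simp
    obtain A m where A: "A > 0" and expl: "\<And>n \<xi>. n \<ge> 1 \<Longrightarrow> indep_vars (\<lambda>_. borel) \<xi> {..<n} \<Longrightarrow>
      (\<And>k B. k < n \<Longrightarrow> B \<in> sets borel \<Longrightarrow>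
         prob (\<xi> k -` B \<inter> space M) \<ge> 1 * measure (pareto \<alpha> :: (real ^ 'd) measure) B) \<Longrightarrow>
      {\<omega> \<in> space M. norm (noise_chain
          (euler_step f g (T / real n) (T powr (1 / \<alpha>) / \<sigma> * real n powr (- (1 / \<alpha>)))) x0 (\<lambda>i. \<xi> i \<omega>) n) \<ge> 2 powr (l ^ (n - 1))} \<in> events \<and>
      prob {\<omega> \<in> space M. norm (noise_chain
          (euler_step f g (T / real n) (T powr (1 / \<alpha>) / \<sigma> * real n powr (- (1 / \<alpha>)))) x0 (\<lambda>i. \<xi> i \<omega>) n) \<ge> 2 powr (l ^ (n - 1))}
        \<ge> A * real n powr (- m) * (1 * (1 - 2 powr (-\<alpha>))) ^ n"
      by (rule euler_explosion_prob[OF pareto \<alpha> T b0 x0 zero_less_one \<open>prob_space M\<close>]) blast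
    show ?thesis
    proof (rule that[OF A])
      fix n :: nat assume n: "n \<ge> 1"
      have coeff: "1 / \<sigma> * (T / real n) powr (1 / \<alpha>) = T powr (1 / \<alpha>) / \<sigma> * real n powr (- (1 / \<alpha>))"
        by (simp add: scale)
      have Yt_eq: "Yt n = (\<lambda>\<omega>. noise_chain
          (euler_step f g (T / real n) (T powr (1 / \<alpha>) / \<sigma> * real n powr (- (1 / \<alpha>)))) x0 (\<lambda>i. Zt (Suc i) \<omega>) n)"
        by (rule ext) (simp only: Yt_def pareto_euler_eq_noise_chain \<sigma>_def[symmetric] coeff)
      have "indep_vars (\<lambda>_. borel) (\<lambda>k. Zt (Suc k)) {..<n}"
        by (rule indep_vars_reindex_inj[OF Xind]) auto
      moreover have "prob (Zt (Suc k) -` B \<inter> space M) \<ge> 1 * measure (pareto \<alpha> :: (real ^ 'd) measure) B"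
        if "B \<in> sets borel" for k B
        using that distributed_measurable[OF Xdist[of "Suc k"]]
        by (simp add: Xlaw[of "Suc k", symmetric] measure_distr)
      ultimately have "{\<omega> \<in> space M. norm (noise_chain
          (euler_step f g (T / real n) (T powr (1 / \<alpha>) / \<sigma> * real n powr (- (1 / \<alpha>)))) x0 (\<lambda>i. Zt (Suc i) \<omega>) n) \<ge> 2 powr (l ^ (n - 1))} \<in> events \<and>
      prob {\<omega> \<in> space M. norm (noise_chain
          (euler_step f g (T / real n) (T powr (1 / \<alpha>) / \<sigma> * real n powr (- (1 / \<alpha>)))) x0 (\<lambda>i. Zt (Suc i) \<omega>) n) \<ge> 2 powr (l ^ (n - 1))}
        \<ge> A * real n powr (- m) * (1 * (1 - 2 powr (-\<alpha>))) ^ n"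
        by (intro expl n) auto
      moreover have "(1 * (1 - 2 powr (-\<alpha>))) ^ n = kappa \<alpha> powr (- real n)"
        unfolding kappa_inverse using kappa_pos[OF \<alpha>] by (simp add: powr_minus powr_realpow power_inverse)
      ultimately show "E Yt n \<in> sets M \<and> prob (E Yt n) \<ge> A * real n powr (- m) * kappa \<alpha> powr (- real n)"
        unfolding E_def Yt_eq by (simp only:)
    qed
  qed

  obtain A1 m1 where A1: "A1 > 0"
    and key1: "\<And>n. n \<ge> 1 \<Longrightarrow> E Y n \<in> sets M \<and> prob (E Y n) \<ge> A1 * real n powr (- m1) * delta CARD('d) \<alpha> K powr (- real n)"
  proof -
    have b0: "T powr (1 / \<alpha>) > 0" using T by simp
    define \<theta> where "\<theta> = stable_weight CARD('d) \<alpha> K"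
    have \<theta>: "\<theta> > 0" unfolding \<theta>_def by (rule stable_weight_pos[OF \<alpha> \<open>K \<ge> 1\<close>]) simp
    obtain A m where A: "A > 0" and expl: "\<And>n \<xi>. n \<ge> 1 \<Longrightarrow> indep_vars (\<lambda>_. borel) \<xi> {..<n} \<Longrightarrow>
      (\<And>k B. k < n \<Longrightarrow> B \<in> sets borel \<Longrightarrow>
         prob (\<xi> k -` B \<inter> space M) \<ge> \<theta> * measure (pareto \<alpha> :: (real ^ 'd) measure) B) \<Longrightarrow>
      {\<omega> \<in> space M. norm (noise_chain
          (euler_step f g (T / real n) (T powr (1 / \<alpha>) * real n powr (- (1 / \<alpha>)))) x0 (\<lambda>i. \<xi> i \<omega>) n) \<ge> 2 powr (l ^ (n - 1))} \<in> events \<and>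
      prob {\<omega> \<in> space M. norm (noise_chain
          (euler_step f g (T / real n) (T powr (1 / \<alpha>) * real n powr (- (1 / \<alpha>)))) x0 (\<lambda>i. \<xi> i \<omega>) n) \<ge> 2 powr (l ^ (n - 1))}
        \<ge> A * real n powr (- m) * (\<theta> * (1 - 2 powr (-\<alpha>))) ^ n"
      by (rule euler_explosion_prob[OF pareto \<alpha> T b0 x0 \<theta> \<open>prob_space M\<close>]) blast
    have levy: "levy_process M Z" using \<open>standard_stable_process M \<alpha> Z\<close> by (simp add: standard_stable_process_def)
    show ?thesis
    proof (rule that[OF A])
      fix n :: nat assume n: "n \<ge> 1"
      define \<eta> where "\<eta> = T / real n"
      define b where "b = \<eta> powr (1 / \<alpha>)"
      have \<eta>: "\<eta> > 0" using T n by (simp add: \<eta>_def)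
      then have b: "b > 0" by (simp add: b_def)
      define D where "D k \<omega> = Z (real (Suc k) * \<eta>) \<omega> - Z (real k * \<eta>) \<omega>" for k \<omega>
      have b_eq: "b = T powr (1 / \<alpha>) * real n powr (- (1 / \<alpha>))" by (simp only: b_def \<eta>_def scale)
      have Y_eq: "Y n = (\<lambda>\<omega>. noise_chain
          (euler_step f g (T / real n) (T powr (1 / \<alpha>) * real n powr (- (1 / \<alpha>)))) x0 (\<lambda>i. inverse b *\<^sub>R D i \<omega>) n)"
        unfolding Y_def \<eta>_def[symmetric] b_eq[symmetric] D_def
        by (rule ext) (rule stable_euler_eq_noise_chain[OF b])
      have Dind: "indep_vars (\<lambda>_. borel) D {..<n}"
      proof -
        have "0 \<le> real 0 * \<eta> \<and> (\<forall>i<n. real i * \<eta> \<le> real (Suc i) * \<eta>)"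
          using \<eta> by (auto intro!: mult_right_mono)
        then show ?thesis using levy unfolding levy_process_def D_def
          by (elim conjE) (drule spec[where x = n], drule spec[where x = "\<lambda>i. real i * \<eta>"], simp)
      qed
      have Dlaw: "distr M borel (D k) = distr M borel (Z \<eta>)" for k
      proof -
        have "distr M borel (\<lambda>\<omega>. Z (real k * \<eta> + \<eta>) \<omega> - Z (real k * \<eta>) \<omega>) = distr M borel (Z \<eta>)"
          using levy \<eta> unfolding levy_process_def by auto
        then show ?thesis unfolding D_def by (simp add: algebra_simps)
      qed
      have Zm [measurable]: "Z t \<in> borel_measurable M" if "t \<ge> 0" for t
        using levy that by (simp add: levy_process_def)
      have Z\<eta> [measurable]: "Z \<eta> \<in> borel_measurable M" using Zm \<eta> by simp
      have Dm [measurable]: "D k \<in> borel_measurable M" for k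
        unfolding D_def using \<eta> by (intro borel_measurable_diff Zm) auto
      have "indep_vars (\<lambda>_. borel) (\<lambda>k \<omega>. inverse b *\<^sub>R D k \<omega>) {..<n}"
        by (rule indep_vars_compose2[OF Dind]) auto
      moreover have "prob ((\<lambda>\<omega>. inverse b *\<^sub>R D k \<omega>) -` B \<inter> space M) \<ge> \<theta> * measure (pareto \<alpha> :: (real ^ 'd) measure) B"
        if B: "B \<in> sets borel" for k B
      proof -
        interpret P: prob_space "pareto \<alpha> :: (real ^ 'd) measure" by (rule pareto)
        have "distr M borel (\<lambda>\<omega>. inverse b *\<^sub>R D k \<omega>) = distr (distr M borel (D k)) borel (\<lambda>x. inverse b *\<^sub>R x)"
          by (subst distr_distr) (auto simp: comp_def)
        also have "\<dots> = distr M borel (\<lambda>\<omega>. inverse b *\<^sub>R Z \<eta> \<omega>)"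
          unfolding Dlaw by (subst distr_distr) (auto simp: comp_def)
        finally have law: "distr M borel (\<lambda>\<omega>. inverse b *\<^sub>R D k \<omega>) = distr M borel (\<lambda>\<omega>. inverse b *\<^sub>R Z \<eta> \<omega>)" .
        have "ennreal \<theta> * emeasure (pareto \<alpha>) B \<le> emeasure (distr M borel (\<lambda>\<omega>. inverse b *\<^sub>R D k \<omega>)) B"
          unfolding law unfolding b_def \<theta>_def
          using \<open>transition_density M Z p\<close> \<open>stable_density_bounds \<alpha> K p\<close> \<eta>
          by (intro emeasure_scaled_stable_ge[where p = "p \<eta>"] \<alpha> \<open>K \<ge> 1\<close> B)
             (auto simp: transition_density_def stable_density_bounds_def)
        also have "\<dots> = ennreal (prob ((\<lambda>\<omega>. inverse b *\<^sub>R D k \<omega>) -` B \<inter> space M))"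
          using B by (simp add: emeasure_distr emeasure_eq_measure)
        finally show ?thesis using \<theta> by (simp add: P.emeasure_eq_measure flip: ennreal_mult')
      qed
      ultimately have "{\<omega> \<in> space M. norm (noise_chain
          (euler_step f g (T / real n) (T powr (1 / \<alpha>) * real n powr (- (1 / \<alpha>)))) x0 (\<lambda>i. inverse b *\<^sub>R D i \<omega>) n) \<ge> 2 powr (l ^ (n - 1))} \<in> events \<and>
      prob {\<omega> \<in> space M. norm (noise_chain
          (euler_step f g (T / real n) (T powr (1 / \<alpha>) * real n powr (- (1 / \<alpha>)))) x0 (\<lambda>i. inverse b *\<^sub>R D i \<omega>) n) \<ge> 2 powr (l ^ (n - 1))}
        \<ge> A * real n powr (- m) * (\<theta> * (1 - 2 powr (-\<alpha>))) ^ n"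
        by (intro expl n) auto
      moreover have "(\<theta> * (1 - 2 powr (-\<alpha>))) ^ n = delta CARD('d) \<alpha> K powr (- real n)"
        unfolding \<theta>_def delta_inverse using delta_pos[OF \<alpha> \<open>K \<ge> 1\<close>, of "CARD('d)"]
        by (simp add: powr_minus powr_realpow power_inverse)
      ultimately show "E Y n \<in> sets M \<and> prob (E Y n) \<ge> A * real n powr (- m) * delta CARD('d) \<alpha> K powr (- real n)"
        unfolding E_def Y_eq by (simp only:)
    qed
  qed

  have "\<forall>\<^sub>F c in at_top. c > 1 \<and> (\<forall>n\<ge>2. c * real n powr (- c) \<le> A1 * real n powr (- m1))
      \<and> (\<forall>n\<ge>2. c * real n powr (- c) \<le> A2 * real n powr (- m2))"
    by (intro eventually_conj eventually_gt_at_top eventually_const_powr_le A1 A2)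
  then obtain c where c: "c > 1"
    "\<And>n. n \<ge> 2 \<Longrightarrow> c * real n powr (- c) \<le> A1 * real n powr (- m1)"
    "\<And>n. n \<ge> 2 \<Longrightarrow> c * real n powr (- c) \<le> A2 * real n powr (- m2)"
    by (auto dest!: eventually_happens)
  have dpos: "delta CARD('d) \<alpha> K > 0" by (rule delta_pos[OF \<alpha> \<open>K \<ge> 1\<close>]) simp
  have kpos: "kappa \<alpha> > 0" by (rule kappa_pos[OF \<alpha>])
  have events: "\<exists>\<Omega> :: nat \<Rightarrow> 'w set.
         (\<forall>n\<ge>1. \<Omega> n \<in> sets M \<and> \<Omega> n \<noteq> {} \<and> measure M (\<Omega> n) > 0 \<and>
            (\<forall>\<omega>\<in>\<Omega> n. norm (V n \<omega>) \<ge> 2 powr (l ^ (n - 1)))) \<and>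
         (\<forall>n\<ge>2. measure M (\<Omega> n) \<ge> c * real n powr (- c) * D powr (- real n))"
    if A: "A > 0" and D: "D > 0" and cA: "\<And>n. n \<ge> 2 \<Longrightarrow> c * real n powr (- c) \<le> A * real n powr (- m)"
      and key: "\<And>n. n \<ge> 1 \<Longrightarrow> E V n \<in> sets M \<and> prob (E V n) \<ge> A * real n powr (- m) * D powr (- real n)"
    for V A m D
  proof (intro exI[of _ "E V"] conjI allI impI)
    fix n :: nat assume n: "n \<ge> 1"
    have "0 < A * real n powr (- m) * D powr (- real n)" using A D n by simp
    also have "\<dots> \<le> prob (E V n)" using key[OF n] by blast
    finally show pos: "prob (E V n) > 0" .
    then show "E V n \<noteq> {}" by auto
    show "E V n \<in> sets M" using key[OF n] by blast
    show "\<forall>\<omega>\<in>E V n. norm (V n \<omega>) \<ge> 2 powr (l ^ (n - 1))" by (simp add: E_def)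
  next
    fix n :: nat assume n: "n \<ge> 2"
    have "c * real n powr (- c) * D powr (- real n) \<le> A * real n powr (- m) * D powr (- real n)"
      using cA[OF n] by (intro mult_right_mono) auto
    also have "\<dots> \<le> prob (E V n)" using key[of n] n by simp
    finally show "prob (E V n) \<ge> c * real n powr (- c) * D powr (- real n)" .
  qed
  have diverge: "(\<lambda>n. \<integral>\<^sup>+\<omega>. ennreal (norm (V n \<omega>) powr \<beta>) \<partial>M) \<longlonglongrightarrow> \<infinity>"
    if "A > 0" "D > 0" "\<beta> > 0"
      and key: "\<And>n. n \<ge> 1 \<Longrightarrow> E V n \<in> sets M \<and> prob (E V n) \<ge> A * real n powr (- m) * D powr (- real n)"
    for V A m D \<beta>
  proof (rule moments_diverge[OF _ _ that(1-3) l])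
    fix n :: nat assume n: "n \<ge> 1"
    show "{\<omega> \<in> space M. norm (V n \<omega>) \<ge> 2 powr (l ^ (n - 1))} \<in> events"
      unfolding E_def[symmetric] using key[OF n] by blast
    show "emeasure M {\<omega> \<in> space M. norm (V n \<omega>) \<ge> 2 powr (l ^ (n - 1))}
        \<ge> ennreal (A * real n powr (- m) * D powr (- real n))"
      unfolding E_def[symmetric] emeasure_eq_measure using key[OF n] by (intro ennreal_leI) blast
  qed
  show ?thesis
    by (intro conjI exI[of _ c] allI impI c(1) events[OF A1 dpos c(2) key1] events[OF A2 kpos c(3) key2]
        diverge[OF A1 dpos _ key1] diverge[OF A2 kpos _ key2]) auto
qed

end
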